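(* Let $T_0$ be a closed, symmetric (densely defined) operator in a complex Hilbert space $H$ with equal and finite deficiency indices, with common value $\mathrm{def}(T_0)$, and let $T_1=T_0^*$, so that $T_0\subseteq T_1$, $T_0^*=T_1$ and $T_1^*=T_0$. Let $W$ be a finite-dimensional complex Hilbert space with $\dim W\le \mathrm{def}(T_0)$ and orthonormal basis $\{\xi_j\mid j=1,\ldots,\dim W\}$, let $B:W\to W$ be self-adjoint, and let $\{t_j\mid j=1,\ldots,\dim W\}\subseteq\mathcal D(T_1)$ be a partial GKN set for $T_0$. Let $\Psi$, $\Omega$, $\widehat T_0$, $\widehat T_1$ and $[\cdot,\cdot]_{H\oplus W}$ be the maps, operators and form constructed from these data as described in the context. Then: (a) $\widehat T_0$ is a closed, symmetric operator in $H\oplus W$ satisfying $\widehat T_0\subseteq\widehat T_1$, with $(\widehat T_0)^*=\widehat T_1$ and $(\widehat T_1)^*=\widehat T_0$. (b) The deficiency indices of $\widehat T_0$ are equal and finite, and $\mathrm{def}(\widehat T_0)=\mathrm{def}(T_0)$. (c) Suppose $\widehat T$ is a self-adjoint operator in $H\oplus W$ with $\widehat T_0\subseteq\widehat T\subseteq\widehat T_1$. Then there exists a set $\{(x_j,a_j)\mid j=1,\ldots,\mathrm{def}(T_0)\}\subseteq\mathcal D(\widehat T_1)$ satisfying ($\alpha$) $\{(x_j,a_j)\mid j=1,\ldots,\mathrm{def}(T_0)\}$ is linearly independent modulo $\mathcal D(\widehat T_0)$, and ($\beta$) $[(x_j,a_j),(x_k,a_k)]_{H\oplus W}=0$ for $j,k=1,\ldots,\mathrm{def}(T_0)$,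 such that $$\widehat T(x,a)=(T_1x,\,Ba-\Omega x),\qquad \mathcal D(\widehat T)=\{(x,a)\in\mathcal D(\widehat T_1)\mid [(x,a),(x_j,a_j)]_{H\oplus W}=0\ (j=1,\ldots,\mathrm{def}(T_0))\}.\qquad( * )$$ (d) Conversely, if $\widehat T$ is defined by $( * )$, where $\{(x_j,a_j)\mid j=1,\ldots,\mathrm{def}(T_0)\}\subseteq\mathcal D(\widehat T_1)$ satisfies ($\alpha$) and ($\beta$), then $\widehat T$ is a self-adjoint extension of $\widehat T_0$ (equivalently, a self-adjoint restriction of $\widehat T_1$) in $H\oplus W$.
   Context: Inner products are linear in the first argument. The deficiency indices of a closed symmetric operator $S$ are the dimensions of $\{x\in\mathcal D(S^* )\mid S^*x=ix\}$ and $\{x\in\mathcal D(S^* )\mid S^*x=-ix\}$; when equal, their common value is $\mathrm{def}(S)$. $[x,y]_H:=\langle T_1x,y\rangle_H-\langle x,T_1y\rangle_H$ for $x,y\in\mathcal D(T_1)$. A set of vectors $v_1,\dots,v_m$ is linearly independent modulo a subspace $D$ if $\sum_j\alpha_jv_j\in D$ implies all $\alpha_j=0$. A partial GKN set here is a set $\{t_j\mid j=1,\ldots,\dim W\}\subseteq\mathcal D(T_1)$ that is linearly independent modulo $\mathcal D(T_0)$ and satisfies $[t_i,t_j]_H=0$ for all $i,j=1,\ldots,\dim W$. $H\oplus W=\{(x,a)\mid x\in H,\ a\in W\}$ with inner product $\langle (x,a),(y,b)\rangle_{H\oplus W}=\langle x,y\rangle_H+\langle a,b\rangle_W$. $\Delta_0:=\mathcal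 D(T_0)+\mathrm{span}\{t_j\mid j=1,\ldots,\dim W\}$. $\Psi:\Delta_0\to W$ is the linear map $\Psi\big(x_0+\sum_{j=1}^{\dim W}\alpha_jt_j\big)=\sum_{j=1}^{\dim W}\alpha_j\xi_j$ ($x_0\in\mathcal D(T_0)$, $\alpha_j\in\mathbb C$). $\Omega:\mathcal D(T_1)\to W$ is the linear map $\Omega x=\sum_{j=1}^{\dim W}[x,t_j]_H\,\xi_j$. $\widehat T_0$ (minimal operator): $\mathcal D(\widehat T_0)=\{(x,\Psi x)\mid x\in\Delta_0\}$, $\widehat T_0(x,a)=(T_1x,Ba)$. $\widehat T_1$ (maximal operator): $\mathcal D(\widehat T_1)=\{(x,a)\mid x\in\mathcal D(T_1),\ a\in W\}$, $\widehat T_1(x,a)=(T_1x,\,Ba-\Omega x)$. $[(x,a),(y,b)]_{H\oplus W}:=[x,y]_H-\langle\Omega x,b\rangle_W+\langle a,\Omega y\rangle_W$ for $(x,a),(y,b)\in\mathcal D(\widehat T_1)$. *)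

theory Defs
  imports "HOL-Analysis.Analysis"
begin

section \<open>Complex Hilbert spaces\<close>

class complex_vector = real_vector +
  fixes scaleC :: "complex \<Rightarrow> 'a \<Rightarrow> 'a" (infixr \<open>*\<^sub>C\<close> 75)
  assumes scaleC_add_right: "c *\<^sub>C (x + y) = c *\<^sub>C x + c *\<^sub>C y"
    and scaleC_add_left: "(c + d) *\<^sub>C x = c *\<^sub>C x + d *\<^sub>C x"
    and scaleC_scaleC: "c *\<^sub>C (d *\<^sub>C x) = (c * d) *\<^sub>C x"
    and scaleC_one: "1 *\<^sub>C x = x"
    and scaleR_scaleC: "r *\<^sub>R x = complex_of_real r *\<^sub>C x"

global_interpretation complex_vector:
  vector_space "scaleC :: complex \<Rightarrow> 'a::complex_vector \<Rightarrow> 'a"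
  by unfold_locales (fact scaleC_add_right scaleC_add_left scaleC_scaleC scaleC_one)+

abbreviation cspan :: "'a::complex_vector set \<Rightarrow> 'a set"
  where "cspan \<equiv> complex_vector.span"
abbreviation csubspace :: "'a::complex_vector set \<Rightarrow> bool"
  where "csubspace \<equiv> complex_vector.subspace"
abbreviation cdim :: "'a::complex_vector set \<Rightarrow> nat"
  where "cdim \<equiv> complex_vector.dim"

text \<open>
  The library's \<^const>\<open>Vector_Spaces.vector_space.dim\<close> is a natural number also for
  infinite-dimensional spaces, so finiteness of a dimension has to be stated separately.
\<close>

definition cfinite_dim :: "'a::complex_vector set \<Rightarrow> bool"
  where "cfinite_dim S \<longleftrightarrow> (\<exists>F. finite F \<and> S \<subseteq> cspan F)"

text \<open>
  The complex inner product is linear in the first argument. Norm and topology are those of the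
  underlying real inner product space, whose inner product is the real part of the complex one;
  positive definiteness is inherited from there (see \<open>cinner_self\<close> below).
\<close>

class complex_inner = complex_vector + real_inner +
  fixes cinner :: "'a \<Rightarrow> 'a \<Rightarrow> complex"
  assumes cinner_commute: "cinner x y = cnj (cinner y x)"
    and cinner_add_left: "cinner (x + y) z = cinner x z + cinner y z"
    and cinner_scaleC_left: "cinner (c *\<^sub>C x) y = c * cinner x y"
    and inner_eq_Re_cinner: "inner x y = Re (cinner x y)"

lemma cinner_self: "cinner x x = complex_of_real ((norm x)\<^sup>2)" for x :: "'a::complex_inner"
proof (rule complex_eqI)
  show "Re (cinner x x) = Re (complex_of_real ((norm x)\<^sup>2))"
    by (simp add: inner_eq_Re_cinner[symmetric] power2_norm_eq_inner)
  show "Im (cinner x x) = Im (complex_of_real ((norm x)\<^sup>2))"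
    using arg_cong[OF cinner_commute[of x x], of Im] by simp
qed

class chilbert_space = complex_inner + complete_space

instantiation complex :: chilbert_space
begin
definition scaleC_complex :: "complex \<Rightarrow> complex \<Rightarrow> complex" where "scaleC_complex c z = c * z"
definition cinner_complex :: "complex \<Rightarrow> complex \<Rightarrow> complex" where "cinner_complex z w = z * cnj w"
instance
  by standard
    (auto simp: scaleC_complex_def cinner_complex_def algebra_simps scaleR_conv_of_real
      inner_complex_def)
end

text \<open>The orthogonal sum: the norm of the library's product type is \<open>sqrt (norm x ^ 2 + norm a ^ 2)\<close>.\<close>

instantiation prod :: (complex_vector, complex_vector) complex_vector
begin
definition scaleC_prod :: "complex \<Rightarrow> 'a \<times> 'b \<Rightarrow> 'a \<times> 'b"
  where "scaleC_prod c z = (c *\<^sub>C fst z, c *\<^sub>C snd z)"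
instance
  by standard
    (auto simp: scaleC_prod_def prod_eq_iff scaleC_add_right scaleC_add_left scaleC_scaleC
      scaleC_one scaleR_scaleC)
end

instantiation prod :: (complex_inner, complex_inner) complex_inner
begin
definition cinner_prod :: "'a \<times> 'b \<Rightarrow> 'a \<times> 'b \<Rightarrow> complex"
  where "cinner_prod z w = cinner (fst z) (fst w) + cinner (snd z) (snd w)"
instance
proof
  fix x y z :: "'a \<times> 'b" and c :: complex
  show "cinner x y = cnj (cinner y x)"
    unfolding cinner_prod_def
    using cinner_commute[of "fst x" "fst y"] cinner_commute[of "snd x" "snd y"] by simp
qed (simp_all add: cinner_prod_def scaleC_prod_def cinner_add_left cinner_scaleC_left
      inner_prod_def inner_eq_Re_cinner algebra_simps)
end

instance prod :: (chilbert_space, chilbert_space) chilbert_space ..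


section \<open>Unbounded operators\<close>

text \<open>
  An operator is a partial function: its domain is \<^term>\<open>dom T\<close>, its value at
  \<^term>\<open>x \<in> dom T\<close> is \<^term>\<open>the (T x)\<close>, and \<^term>\<open>S \<subseteq>\<^sub>m T\<close> says that
  \<^term>\<open>T\<close> extends \<^term>\<open>S\<close>. Equality of partial functions is equality of domains and values.
\<close>

type_synonym ('a, 'b) operator = "'a \<rightharpoonup> 'b"

definition op_on :: "'a set \<Rightarrow> ('a \<Rightarrow> 'b) \<Rightarrow> ('a, 'b) operator"
  where "op_on D f = (\<lambda>x. if x \<in> D then Some (f x) else None)"

definition linear_operator :: "('a::complex_vector, 'b::complex_vector) operator \<Rightarrow> bool"
  where "linear_operator T \<longleftrightarrow> csubspace (dom T) \<and>
    (\<forall>x\<in>dom T. \<forall>y\<in>dom T. the (T (x + y)) = the (T x) + the (T y)) \<and>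
    (\<forall>c. \<forall>x\<in>dom T. the (T (c *\<^sub>C x)) = c *\<^sub>C the (T x))"

definition densely_defined :: "('a::topological_space, 'b) operator \<Rightarrow> bool"
  where "densely_defined T \<longleftrightarrow> closure (dom T) = UNIV"

definition closed_operator :: "('a::topological_space, 'b::topological_space) operator \<Rightarrow> bool"
  where "closed_operator T \<longleftrightarrow> closed (Map.graph T)"

definition symmetric_operator :: "('a::complex_inner, 'a) operator \<Rightarrow> bool"
  where "symmetric_operator T \<longleftrightarrow> linear_operator T \<and> densely_defined T \<and>
    (\<forall>x\<in>dom T. \<forall>y\<in>dom T. cinner (the (T x)) y = cinner x (the (T y)))"

text \<open>The value of the adjoint is unique if \<^term>\<open>T\<close> is densely defined (\<open>op_adjoint_eqI\<close>).\<close>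

definition op_adjoint :: "('a::complex_inner, 'a) operator \<Rightarrow> ('a, 'a) operator"
  where "op_adjoint T = op_on
    {y. \<exists>z. \<forall>x\<in>dom T. cinner (the (T x)) y = cinner x z}
    (\<lambda>y. THE z. \<forall>x\<in>dom T. cinner (the (T x)) y = cinner x z)"

definition self_adjoint :: "('a::complex_inner, 'a) operator \<Rightarrow> bool"
  where "self_adjoint T \<longleftrightarrow> linear_operator T \<and> densely_defined T \<and> op_adjoint T = T"

definition defect_space :: "('a::complex_inner, 'a) operator \<Rightarrow> complex \<Rightarrow> 'a set"
  where "defect_space T c = {x \<in> dom (op_adjoint T). the (op_adjoint T x) = c *\<^sub>C x}"

definition equal_finite_deficiency :: "('a::complex_inner, 'a) operator \<Rightarrow> bool"
  where "equal_finite_deficiency T \<longleftrightarrow>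
    cfinite_dim (defect_space T \<i>) \<and> cfinite_dim (defect_space T (- \<i>)) \<and>
    cdim (defect_space T \<i>) = cdim (defect_space T (- \<i>))"

text \<open>The common value of the deficiency indices; meaningful under \<^const>\<open>equal_finite_deficiency\<close>.\<close>

definition deficiency :: "('a::complex_inner, 'a) operator \<Rightarrow> nat"
  where "deficiency T = cdim (defect_space T \<i>)"

lemma op_adjoint_eqI:
  fixes T :: "('a::complex_inner, 'a) operator"
  assumes dense: "densely_defined T"
    and z: "\<And>x. x \<in> dom T \<Longrightarrow> cinner (the (T x)) y = cinner x z"
  shows "op_adjoint T y = Some z"
proof -
  have "z' = z" if z': "\<forall>x\<in>dom T. cinner (the (T x)) y = cinner x z'" for z'
  proof -
    have "dom T \<subseteq> {x. inner x (z' - z) = 0}"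
    proof
      fix x assume "x \<in> dom T"
      then have "cinner x z' = cinner x z" using z z' by metis
      then show "x \<in> {x. inner x (z' - z) = 0}"
        by (simp add: inner_diff_right inner_eq_Re_cinner[of x z] inner_eq_Re_cinner[of x z'])
    qed
    moreover have "closed {x. inner x (z' - z) = 0}"
      by (intro closed_Collect_eq continuous_intros)
    ultimately have "closure (dom T) \<subseteq> {x. inner x (z' - z) = 0}"
      by (rule closure_minimal)
    then have "inner (z' - z) (z' - z) = 0"
      using dense unfolding densely_defined_def by blast
    then show ?thesis by simp
  qed
  then have "(THE z. \<forall>x\<in>dom T. cinner (the (T x)) y = cinner x z) = z"
    using z by (intro the_equality) blast+
  then show ?thesis
    using z unfolding op_adjoint_def op_on_def by auto
qed


section \<open>Partial GKN sets and the extended operators\<close>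

text \<open>
  Finite sets of vectors such as \<open>t\<^sub>1, \<dots>, t\<^sub>m\<close> are given as families indexed by
  \<^term>\<open>{1..m}\<close>.
\<close>

definition lin_indep_mod :: "nat \<Rightarrow> (nat \<Rightarrow> 'a::complex_vector) \<Rightarrow> 'a set \<Rightarrow> bool"
  where "lin_indep_mod m v D \<longleftrightarrow>
    (\<forall>\<alpha>. (\<Sum>j\<in>{1..m}. \<alpha> j *\<^sub>C v j) \<in> D \<longrightarrow> (\<forall>j\<in>{1..m}. \<alpha> j = 0))"

definition orthonormal_basis :: "nat \<Rightarrow> (nat \<Rightarrow> 'w::complex_inner) \<Rightarrow> bool"
  where "orthonormal_basis m \<xi> \<longleftrightarrow>
    (\<forall>j\<in>{1..m}. \<forall>k\<in>{1..m}. cinner (\<xi> j) (\<xi> k) = (if j = k then 1 else 0)) \<and>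
    cspan (\<xi> ` {1..m}) = UNIV"

definition bform :: "('h::complex_inner, 'h) operator \<Rightarrow> 'h \<Rightarrow> 'h \<Rightarrow> complex"
  where "bform T1 x y = cinner (the (T1 x)) y - cinner x (the (T1 y))"

definition partial_GKN_set ::
  "('h::complex_inner, 'h) operator \<Rightarrow> ('h, 'h) operator \<Rightarrow> nat \<Rightarrow> (nat \<Rightarrow> 'h) \<Rightarrow> bool"
  where "partial_GKN_set T0 T1 m t \<longleftrightarrow>
    (\<forall>j\<in>{1..m}. t j \<in> dom T1) \<and> lin_indep_mod m t (dom T0) \<and>
    (\<forall>i\<in>{1..m}. \<forall>j\<in>{1..m}. bform T1 (t i) (t j) = 0)"

text \<open>
  The space \<open>W\<close> is the type \<open>'w\<close>, so \<open>dim W\<close> is the dimension of \<^term>\<open>UNIV\<close>. The value of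
  \<open>Psi\<close> does not depend on the chosen decomposition if the \<open>t\<^sub>j\<close> are linearly independent modulo
  the domain of \<open>T0\<close> (\<open>Psi_eq\<close>).
\<close>

definition Delta0 ::
  "('h::complex_inner, 'h) operator \<Rightarrow> nat \<Rightarrow> (nat \<Rightarrow> 'h) \<Rightarrow> 'h set"
  where "Delta0 T0 m t = {x0 + s | x0 s. x0 \<in> dom T0 \<and> s \<in> cspan (t ` {1..m})}"

definition Psi ::
  "('h::complex_inner, 'h) operator \<Rightarrow> (nat \<Rightarrow> 'h) \<Rightarrow> (nat \<Rightarrow> 'w::complex_inner) \<Rightarrow> 'h \<Rightarrow> 'w"
  where "Psi T0 t \<xi> x = (THE a. \<exists>x0\<in>dom T0. \<exists>\<alpha>.
    x = x0 + (\<Sum>j\<in>{1..cdim (UNIV :: 'w set)}. \<alpha> j *\<^sub>C t j) \<and>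
    a = (\<Sum>j\<in>{1..cdim (UNIV :: 'w set)}. \<alpha> j *\<^sub>C \<xi> j))"

lemma Psi_eq:
  fixes \<xi> :: "nat \<Rightarrow> 'w::complex_inner"
  defines "m \<equiv> cdim (UNIV :: 'w set)"
  assumes "linear_operator T0" and "lin_indep_mod m t (dom T0)" and "x0 \<in> dom T0"
  shows "Psi T0 t \<xi> (x0 + (\<Sum>j\<in>{1..m}. \<alpha> j *\<^sub>C t j)) = (\<Sum>j\<in>{1..m}. \<alpha> j *\<^sub>C \<xi> j)"
  unfolding Psi_def m_def[symmetric]
proof (rule the_equality)
  show "\<exists>x0'\<in>dom T0. \<exists>\<beta>. x0 + (\<Sum>j\<in>{1..m}. \<alpha> j *\<^sub>C t j) = x0' + (\<Sum>j\<in>{1..m}. \<beta> j *\<^sub>C t j) \<and>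
      (\<Sum>j\<in>{1..m}. \<alpha> j *\<^sub>C \<xi> j) = (\<Sum>j\<in>{1..m}. \<beta> j *\<^sub>C \<xi> j)"
    using assms(4) by blast
next
  fix a
  assume "\<exists>x0'\<in>dom T0. \<exists>\<beta>. x0 + (\<Sum>j\<in>{1..m}. \<alpha> j *\<^sub>C t j) = x0' + (\<Sum>j\<in>{1..m}. \<beta> j *\<^sub>C t j) \<and>
      a = (\<Sum>j\<in>{1..m}. \<beta> j *\<^sub>C \<xi> j)"
  then obtain x0' \<beta> where x0': "x0' \<in> dom T0"
    and eq: "x0 + (\<Sum>j\<in>{1..m}. \<alpha> j *\<^sub>C t j) = x0' + (\<Sum>j\<in>{1..m}. \<beta> j *\<^sub>C t j)"
    and a: "a = (\<Sum>j\<in>{1..m}. \<beta> j *\<^sub>C \<xi> j)"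
    by blast
  have "(\<Sum>j\<in>{1..m}. (\<alpha> j - \<beta> j) *\<^sub>C t j) = x0' - x0"
    using eq by (simp add: complex_vector.scale_left_diff_distrib sum_subtractf algebra_simps)
  also have "\<dots> \<in> dom T0"
    using assms(2,4) x0' unfolding linear_operator_def
    by (intro complex_vector.subspace_diff) simp_all
  finally have "\<forall>j\<in>{1..m}. \<alpha> j - \<beta> j = 0"
    using assms(3) unfolding lin_indep_mod_def by (auto dest: spec[of _ "\<lambda>j. \<alpha> j - \<beta> j"])
  then show "a = (\<Sum>j\<in>{1..m}. \<alpha> j *\<^sub>C \<xi> j)"
    unfolding a by (intro sum.cong) auto
qed

definition Omega ::
  "('h::complex_inner, 'h) operator \<Rightarrow> (nat \<Rightarrow> 'h) \<Rightarrow> (nat \<Rightarrow> 'w::complex_inner) \<Rightarrow> 'h \<Rightarrow> 'w"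
  where "Omega T1 t \<xi> x = (\<Sum>j\<in>{1..cdim (UNIV :: 'w set)}. bform T1 x (t j) *\<^sub>C \<xi> j)"

definition That0 ::
  "('h::complex_inner, 'h) operator \<Rightarrow> ('h, 'h) operator \<Rightarrow> (nat \<Rightarrow> 'h) \<Rightarrow>
    (nat \<Rightarrow> 'w::complex_inner) \<Rightarrow> ('w \<Rightarrow> 'w) \<Rightarrow> ('h \<times> 'w, 'h \<times> 'w) operator"
  where "That0 T0 T1 t \<xi> B = op_on
    {(x, Psi T0 t \<xi> x) | x. x \<in> Delta0 T0 (cdim (UNIV :: 'w set)) t}
    (\<lambda>(x, a). (the (T1 x), B a))"

definition That1 ::
  "('h::complex_inner, 'h) operator \<Rightarrow> (nat \<Rightarrow> 'h) \<Rightarrow>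
    (nat \<Rightarrow> 'w::complex_inner) \<Rightarrow> ('w \<Rightarrow> 'w) \<Rightarrow> ('h \<times> 'w, 'h \<times> 'w) operator"
  where "That1 T1 t \<xi> B = op_on
    {(x, a) | x a. x \<in> dom T1}
    (\<lambda>(x, a). (the (T1 x), B a - Omega T1 t \<xi> x))"

definition bform_hat ::
  "('h::complex_inner, 'h) operator \<Rightarrow> (nat \<Rightarrow> 'h) \<Rightarrow>
    (nat \<Rightarrow> 'w::complex_inner) \<Rightarrow> 'h \<times> 'w \<Rightarrow> 'h \<times> 'w \<Rightarrow> complex"
  where "bform_hat T1 t \<xi> = (\<lambda>(x, a) (y, b).
    bform T1 x y - cinner (Omega T1 t \<xi> x) b + cinner a (Omega T1 t \<xi> y))"

definition boundary_restriction ::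
  "('h::complex_inner, 'h) operator \<Rightarrow> (nat \<Rightarrow> 'h) \<Rightarrow> (nat \<Rightarrow> 'w::complex_inner) \<Rightarrow>
    ('w \<Rightarrow> 'w) \<Rightarrow> nat \<Rightarrow> (nat \<Rightarrow> 'h \<times> 'w) \<Rightarrow> ('h \<times> 'w, 'h \<times> 'w) operator"
  where "boundary_restriction T1 t \<xi> B n v = op_on
    {z \<in> dom (That1 T1 t \<xi> B). \<forall>j\<in>{1..n}. bform_hat T1 t \<xi> z (v j) = 0}
    (\<lambda>(x, a). (the (T1 x), B a - Omega T1 t \<xi> x))"

end

(*
  Abstractly, if S is closed and symmetric with equal deficiency indices d, then
  H = ran(S + c) + ker(S* - c) orthogonally for c = i, -i. A self-adjoint extension T of S has
  T + i bijective, so dom T / dom S is isomorphic to ker(S* - i) and any basis of it supplies the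
  boundary vectors; conversely, for d isotropic vectors independent modulo dom S, S* restricted to
  their span with dom S has ran(S* + c) = H for both signs by counting dimensions, which forces it
  to be self-adjoint. This applies to the extended minimal operator: dom of it consists of the
  (x, a) with x - sum_j <a, xi_j> t_j in D(T_0), both adjoints are computed from <Omega x, b> =
  [x, sum_j <b, xi_j> t_j], and its defect spaces project isomorphically to those of T_0 because
  B - c is invertible.
*)
theory Submission
  imports Defs
begin

section \<open>Complex inner products and orthogonal projections\<close>

text \<open>All the analysis rests on projecting onto closed subspaces: onto the graph of S, which
  identifies the double adjoint, and onto the range of S + c, closed because S + c is isometric for
  the graph norm when c is purely imaginary. Boundary conditions describe a domain from outside, as
  an annihilator of the boundary form, whereas isotropy and counting speak about a span; the
  sufficiency half has to identify the two, and there both signs of c are needed at once. For the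
  extended operators the obstacle is that \<open>Psi\<close> lives only on \<open>Delta0\<close> and
  is given by a definite description. It is traded for its linear section \<open>lift\<close>,
  defined on all of W. Isotropy of the \<open>t j\<close> makes \<Omega> vanish on
  \<open>Delta0\<close>, so that the minimal and maximal operators agree there. The term -\<Omega> x
  in the maximal operator makes \<open>bform_hat\<close> its ordinary boundary form, and the
  abstract theory then applies without change.\<close>

lemma cinner_add_right: "cinner x (y + z) = cinner x y + cinner x z" for x :: "'a::complex_inner"
  by (metis cinner_add_left cinner_commute complex_cnj_add)

lemma cinner_scaleC_right: "cinner x (c *\<^sub>C y) = cnj c * cinner x y" for x :: "'a::complex_inner"
  by (metis cinner_commute cinner_scaleC_left complex_cnj_mult)

lemma cinner_minus_left: "cinner (- x) y = - cinner x y" for x :: "'a::complex_inner"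
  using cinner_scaleC_left[of "- 1" x y] by (simp add: complex_vector.scale_minus_left scaleC_one)

lemma cinner_minus_right: "cinner x (- y) = - cinner x y" for x :: "'a::complex_inner"
  by (metis cinner_commute cinner_minus_left complex_cnj_minus)

lemma cinner_diff_left: "cinner (x - y) z = cinner x z - cinner y z" for x :: "'a::complex_inner"
  using cinner_add_left[of x "- y" z] by (simp add: cinner_minus_left)

lemma cinner_diff_right: "cinner x (y - z) = cinner x y - cinner x z" for x :: "'a::complex_inner"
  using cinner_add_right[of x y "- z"] by (simp add: cinner_minus_right)

lemma cinner_zero_left [simp]: "cinner 0 x = 0" for x :: "'a::complex_inner"
  using cinner_diff_left[of 0 0 x] by simp

lemma cinner_zero_right [simp]: "cinner x 0 = 0" for x :: "'a::complex_inner"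
  using cinner_diff_right[of x 0 0] by simp

lemma cinner_sum_left: "cinner (\<Sum>j\<in>A. f j) x = (\<Sum>j\<in>A. cinner (f j) x)"
  for x :: "'a::complex_inner"
  by (induction A rule: infinite_finite_induct) (auto simp: cinner_add_left)

lemma cinner_sum_right: "cinner x (\<Sum>j\<in>A. f j) = (\<Sum>j\<in>A. cinner x (f j))"
  for x :: "'a::complex_inner"
  by (induction A rule: infinite_finite_induct) (auto simp: cinner_add_right)

lemma cinner_eq_zero_iff [simp]: "cinner x x = 0 \<longleftrightarrow> x = 0" for x :: "'a::complex_inner"
  by (simp add: cinner_self)

lemmas cinner_simps =
  cinner_add_left cinner_add_right cinner_diff_left cinner_diff_right cinner_scaleC_left
  cinner_scaleC_right cinner_minus_left cinner_minus_right cinner_sum_left cinner_sum_right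

lemma cinner_pair [simp]: "cinner (x, a) (y, b) = cinner x y + cinner a b"
  by (simp add: cinner_prod_def)

lemma scaleC_pair [simp]: "c *\<^sub>C (x, a) = (c *\<^sub>C x, c *\<^sub>C a)"
  by (simp add: scaleC_prod_def)

lemma norm_scaleC: "norm (c *\<^sub>C x) = cmod c * norm x" for x :: "'a::complex_inner"
proof -
  have "complex_of_real ((norm (c *\<^sub>C x))\<^sup>2) = c * cnj c * complex_of_real ((norm x)\<^sup>2)"
    by (simp only: cinner_self[symmetric] cinner_scaleC_left cinner_scaleC_right ac_simps)
  also have "\<dots> = complex_of_real ((cmod c * norm x)\<^sup>2)"
    by (simp only: complex_norm_square[symmetric] power_mult_distrib of_real_mult)
  finally have "(norm (c *\<^sub>C x))\<^sup>2 = (cmod c * norm x)\<^sup>2"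
    by (simp only: of_real_eq_iff)
  then show ?thesis by (simp add: power2_eq_iff_nonneg)
qed

lemma bounded_linear_scaleC: "bounded_linear ((*\<^sub>C) c :: 'a \<Rightarrow> 'a::complex_inner)"
  by (rule bounded_linear_intro[where K = "cmod c"])
    (auto simp: scaleC_add_right scaleR_scaleC scaleC_scaleC norm_scaleC mult.commute)

text \<open>The topology comes from the real inner product, so continuity is reduced to it: the
  imaginary part of \<open>cinner u y\<close> is the real inner product of
  \<open>(- \<i>) *\<^sub>C u\<close> with \<open>y\<close>. It serves to show that graphs of
  adjoints are closed.\<close>

lemma continuous_on_cinner_right [continuous_intros]:
  fixes f :: "'b::topological_space \<Rightarrow> 'a::complex_inner"
  assumes "continuous_on S f"
  shows "continuous_on S (\<lambda>x. cinner u (f x))"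
proof -
  have "cinner u y = of_real (inner u y) + \<i> * of_real (inner ((- \<i>) *\<^sub>C u) y)" for y
    by (rule complex_eqI) (simp_all add: inner_eq_Re_cinner cinner_simps)
  then show ?thesis
    using assms by (simp only:) (intro continuous_intros)
qed

section \<open>Closed subspaces: nearest points and orthogonal projections\<close>

lemma csubspace_imp_subspace: "csubspace S \<Longrightarrow> subspace S"
  by (auto simp: subspace_def complex_vector.subspace_def scaleR_scaleC)

text \<open>A minimizing sequence is Cauchy by the parallelogram identity, because midpoints stay in
  the subspace and so remain at distance at least d from z; completeness of the space supplies the
  limit and closedness keeps it in S.\<close>

lemma nearest_point_exists:
  fixes S :: "'a::{real_inner, complete_space} set"
  assumes S: "subspace S" "closed S"
  shows "\<exists>s\<in>S. \<forall>x\<in>S. dist z s \<le> dist z x"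
proof -
  have ne: "S \<noteq> {}" using subspace_0[OF S(1)] by auto
  define d where "d = infdist z S"
  have d0: "0 \<le> d" by (simp add: d_def infdist_nonneg)
  have dle: "d \<le> norm (x - z)" if "x \<in> S" for x
    unfolding d_def using infdist_le[OF that, of z] by (simp add: dist_norm norm_minus_commute)
  \<comment> \<open>The radius is chosen with its square in mind: squared distances then exceed the
    square of d by less than 1/(n + 1), the form in which the parallelogram identity uses
    them.\<close>
  have "\<exists>x\<in>S. dist z x < sqrt (d\<^sup>2 + 1 / Suc n)" for n
  proof -
    have "sqrt (d\<^sup>2) < sqrt (d\<^sup>2 + 1 / Suc n)"
      by (subst real_sqrt_less_iff) simp
    then have "infdist z S < sqrt (d\<^sup>2 + 1 / Suc n)"
      using d0 d_def by simp
    then show ?thesis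
      using ne by (auto simp: infdist_notempty cINF_less_iff bdd_below_image_dist)
  qed
  then obtain f where fS: "\<And>n. f n \<in> S" and f: "\<And>n. dist z (f n) < sqrt (d\<^sup>2 + 1 / Suc n)"
    by metis
  have f2: "(norm (f n - z))\<^sup>2 < d\<^sup>2 + 1 / Suc n" for n
    using f[of n] real_less_rsqrt by (metis dist_commute dist_norm norm_ge_zero real_sqrt_less_iff
        real_sqrt_unique)
  have par: "(norm (f m - f n))\<^sup>2 \<le> 2 / Suc m + 2 / Suc n" for m n
  proof -
    have "(1/2) *\<^sub>R (f m + f n) \<in> S"
      using fS S(1) by (intro subspace_scale subspace_add) auto
    then have "d\<^sup>2 \<le> (norm ((1/2) *\<^sub>R (f m + f n) - z))\<^sup>2"
      using d0 dle by (intro power_mono) auto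
    moreover have "(norm (f m - f n))\<^sup>2 + 4 * (norm ((1/2) *\<^sub>R (f m + f n) - z))\<^sup>2
        = 2 * (norm (f m - z))\<^sup>2 + 2 * (norm (f n - z))\<^sup>2"
      by (simp add: power2_norm_eq_inner inner_simps inner_commute algebra_simps)
    ultimately show ?thesis using f2[of m] f2[of n] by linarith
  qed
  have "Cauchy f"
  proof (rule metric_CauchyI)
    fix e :: real assume e: "0 < e"
    then obtain N where N: "4 / e\<^sup>2 < real N"
      using reals_Archimedean2 by blast
    have "dist (f m) (f n) < e" if "N \<le> m" "N \<le> n" for m n
    proof -
      have "2 / real (Suc m) + 2 / real (Suc n) \<le> 2 / real (Suc N) + 2 / real (Suc N)"
        using that by (intro add_mono divide_left_mono) auto
      also have "\<dots> = 4 / Suc N" by simp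
      also have "\<dots> < e\<^sup>2"
      proof -
        have "4 < real N * e\<^sup>2" using N e by (simp add: pos_divide_less_eq)
        also have "\<dots> \<le> real (Suc N) * e\<^sup>2" by (rule mult_right_mono) simp_all
        finally show ?thesis by (simp add: pos_divide_less_eq mult.commute)
      qed
      finally have "(norm (f m - f n))\<^sup>2 < e\<^sup>2" using par[of m n] by simp
      then show ?thesis using e power2_less_imp_less[of "norm (f m - f n)" e] by (simp add: dist_norm)
    qed
    then show "\<exists>M. \<forall>m\<ge>M. \<forall>n\<ge>M. dist (f m) (f n) < e" by blast
  qed
  then obtain s where s: "f \<longlonglongrightarrow> s"
    using Cauchy_convergent convergent_def by blast
  have sS: "s \<in> S" using closed_sequentially[OF S(2) fS s] .
  have "(\<lambda>n. (norm (f n - z))\<^sup>2) \<longlonglongrightarrow> (norm (s - z))\<^sup>2"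
    by (intro tendsto_intros s)
  moreover have "(\<lambda>n. d\<^sup>2 + 1 / Suc n) \<longlonglongrightarrow> d\<^sup>2 + 0"
    by (intro tendsto_intros LIMSEQ_Suc[OF lim_1_over_n]) 
  ultimately have "(norm (s - z))\<^sup>2 \<le> d\<^sup>2 + 0"
    by (rule LIMSEQ_le) (use f2 less_imp_le in blast)
  then have "norm (s - z) \<le> d" using d0 power2_le_imp_le[of "norm (s - z)" d] by simp
  then have "dist z s \<le> dist z x" if "x \<in> S" for x
    using dle[OF that] by (simp add: dist_norm norm_minus_commute)
  then show ?thesis using sS by blast
qed

text \<open>The obtuse-angle criterion for the nearest point, applied to x and to -x, gives only
  real orthogonality; testing with \<open>(- \<i>) *\<^sub>C x\<close>, available since S is a
  complex subspace, removes the imaginary part.\<close>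

lemma orthogonal_projection_exists:
  fixes S :: "'a::chilbert_space set"
  assumes S: "csubspace S" "closed S"
  obtains s where "s \<in> S" "\<And>x. x \<in> S \<Longrightarrow> cinner x (z - s) = 0"
proof -
  have sub: "subspace S" by (rule csubspace_imp_subspace[OF S(1)])
  obtain s where s: "s \<in> S" "\<forall>x\<in>S. dist z s \<le> dist z x"
    using nearest_point_exists[OF sub S(2)] by blast
  have le: "inner (z - s) x \<le> 0" if "x \<in> S" for x
    using any_closest_point_dot[OF subspace_imp_convex[OF sub] S(2) s(1) _ s(2), of "x + s"]
      subspace_add[OF sub that s(1)] by simp
  have inner: "inner x (z - s) = 0" if "x \<in> S" for x
    using le[OF that] le[OF subspace_neg[OF sub that]] by (simp add: inner_commute)
  have "cinner x (z - s) = 0" if "x \<in> S" for x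
  proof (rule complex_eqI)
    show "Re (cinner x (z - s)) = Re 0"
      using inner[OF that] by (simp add: inner_eq_Re_cinner)
    have "(- \<i>) *\<^sub>C x \<in> S" using that S(1) by (rule complex_vector.subspace_scale[rotated])
    from inner[OF this] show "Im (cinner x (z - s)) = Im 0"
      by (simp add: inner_eq_Re_cinner cinner_simps)
  qed
  then show thesis using s(1) that by blast
qed

section \<open>Finite families of vectors\<close>

text \<open>Coefficients are attached to indices, not to vectors, so the family may contain
  repetitions.\<close>

lemma cspan_family:
  fixes v :: "'i \<Rightarrow> 'a::complex_vector"
  assumes "finite A"
  shows "cspan (v ` A) = range (\<lambda>\<alpha>. \<Sum>j\<in>A. \<alpha> j *\<^sub>C v j)"
proof
  show "cspan (v ` A) \<subseteq> range (\<lambda>\<alpha>. \<Sum>j\<in>A. \<alpha> j *\<^sub>C v j)"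
  proof (rule complex_vector.span_minimal)
    show "v ` A \<subseteq> range (\<lambda>\<alpha>. \<Sum>j\<in>A. \<alpha> j *\<^sub>C v j)"
    proof
      fix x assume "x \<in> v ` A"
      then obtain i where i: "i \<in> A" "x = v i" by blast
      have "(\<Sum>j\<in>A. (if j = i then 1 else 0) *\<^sub>C v j) = (\<Sum>j\<in>A. if j = i then v j else 0)"
        by (intro sum.cong) (auto simp: scaleC_one)
      then have "x = (\<Sum>j\<in>A. (if j = i then 1 else 0) *\<^sub>C v j)"
        using assms i by simp
      then show "x \<in> range (\<lambda>\<alpha>. \<Sum>j\<in>A. \<alpha> j *\<^sub>C v j)"
        by (rule range_eqI[of _ _ "\<lambda>j. if j = i then 1 else 0"])
    qed
    show "csubspace (range (\<lambda>\<alpha>. \<Sum>j\<in>A. \<alpha> j *\<^sub>C v j))"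
    proof (rule complex_vector.subspaceI; safe?)
      show "0 \<in> range (\<lambda>\<alpha>. \<Sum>j\<in>A. \<alpha> j *\<^sub>C v j)"
        by (rule range_eqI[of _ _ "\<lambda>_. 0"]) simp
      show "(\<Sum>j\<in>A. \<alpha> j *\<^sub>C v j) + (\<Sum>j\<in>A. \<beta> j *\<^sub>C v j) \<in> range (\<lambda>\<alpha>. \<Sum>j\<in>A. \<alpha> j *\<^sub>C v j)"
        for \<alpha> \<beta>
        by (rule range_eqI[of _ _ "\<lambda>j. \<alpha> j + \<beta> j"]) (simp add: scaleC_add_left sum.distrib)
      show "c *\<^sub>C (\<Sum>j\<in>A. \<alpha> j *\<^sub>C v j) \<in> range (\<lambda>\<alpha>. \<Sum>j\<in>A. \<alpha> j *\<^sub>C v j)" for c \<alpha>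
        by (rule range_eqI[of _ _ "\<lambda>j. c * \<alpha> j"])
          (simp add: scaleC_scaleC complex_vector.scale_sum_right)
    qed
  qed
  show "range (\<lambda>\<alpha>. \<Sum>j\<in>A. \<alpha> j *\<^sub>C v j) \<subseteq> cspan (v ` A)"
    by (intro image_subsetI complex_vector.span_sum complex_vector.span_scale
        complex_vector.span_base imageI)
qed

lemma cspan_familyE:
  fixes v :: "nat \<Rightarrow> 'a::complex_vector"
  assumes "x \<in> cspan (v ` {1..m})"
  obtains \<alpha> where "x = (\<Sum>j\<in>{1..m}. \<alpha> j *\<^sub>C v j)"
proof -
  have "x \<in> range (\<lambda>\<alpha>. \<Sum>j\<in>{1..m}. \<alpha> j *\<^sub>C v j)"
    using assms unfolding cspan_family[OF finite_atLeastAtMost] .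
  then show thesis using that by (rule rangeE)
qed

lemma family_in_cspan: "(\<Sum>j\<in>{1..m}. \<alpha> j *\<^sub>C v j) \<in> cspan (v ` {1..m})"
  for v :: "nat \<Rightarrow> 'a::complex_vector"
  unfolding cspan_family[OF finite_atLeastAtMost] by (rule rangeI)

text \<open>Two equal members would satisfy the relation with coefficients 1 and -1, so independence
  of a family modulo zero also rules out repetitions. This links indexed families with independent
  sets and hence with \<open>cdim\<close>.\<close>

lemma lin_indep_mod_zero:
  assumes "lin_indep_mod d v {0}"
  shows "inj_on v {1..d}" and "complex_vector.independent (v ` {1..d})"
proof -
  have zero: "\<alpha> j = 0" if "(\<Sum>j\<in>{1..d}. \<alpha> j *\<^sub>C v j) = 0" "j \<in> {1..d}" for \<alpha> j
    using assms that unfolding lin_indep_mod_def by blast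
  show inj: "inj_on v {1..d}"
  proof (rule inj_onI, rule ccontr)
    fix i j assume ij: "i \<in> {1..d}" "j \<in> {1..d}" "v i = v j" "i \<noteq> j"
    have "(\<Sum>k\<in>{1..d}. (if k = i then 1 else if k = j then - 1 else 0) *\<^sub>C v k)
        = (\<Sum>k\<in>{1..d}. (if k = i then v k else 0) + (if k = j then - v k else 0))"
      using ij by (intro sum.cong) (auto simp: scaleC_one complex_vector.scale_minus_left)
    also have "\<dots> = v i - v j"
      using ij(1,2) by (simp add: sum.distrib)
    finally have "(\<Sum>k\<in>{1..d}. (if k = i then 1 else if k = j then - 1 else 0) *\<^sub>C v k) = 0"
      using ij(3) by simp
    from zero[OF this ij(1)] show False by simp
  qed
  show "complex_vector.independent (v ` {1..d})"
  proof (rule complex_vector.independent_if_scalars_zero)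
    fix f x assume *: "(\<Sum>x\<in>v ` {1..d}. f x *\<^sub>C x) = 0" "x \<in> v ` {1..d}"
    then have "(\<Sum>j\<in>{1..d}. f (v j) *\<^sub>C v j) = 0"
      using inj by (simp add: sum.reindex)
    then show "f x = 0" using zero[of "\<lambda>j. f (v j)"] *(2) by auto
  qed simp
qed

lemma family_basis_cdim:
  assumes "v ` {1..d} \<subseteq> N" "lin_indep_mod d v {0}" "N \<subseteq> cspan (v ` {1..d})"
  shows "cfinite_dim N" and "cdim N = d"
proof -
  show "cfinite_dim N" using assms(3) unfolding cfinite_dim_def by blast
  show "cdim N = d"
    using assms lin_indep_mod_zero[OF assms(2)]
    by (intro complex_vector.dim_unique[of "v ` {1..d}"]) (auto simp: card_image)
qed

lemma family_basis_exists:
  assumes "cfinite_dim N"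
  obtains v where "v ` {1..cdim N} \<subseteq> N" "lin_indep_mod (cdim N) v {0}"
    "N \<subseteq> cspan (v ` {1..cdim N})"
proof -
  obtain B where B: "B \<subseteq> N" "complex_vector.independent B" "N \<subseteq> cspan B" "card B = cdim N"
    by (rule complex_vector.basis_exists)
  \<comment> \<open>Finiteness is settled before counting: for an infinite basis \<open>card\<close>
    would be 0 and there would be no enumeration.\<close>
  obtain F where "finite F" "N \<subseteq> cspan F" using assms unfolding cfinite_dim_def by blast
  then have fin: "finite B"
    using complex_vector.independent_span_bound[OF _ B(2)] subset_trans[OF B(1)] by fast
  obtain v where v: "bij_betw v {1..cdim N} B"
    using ex_bij_betw_nat_finite_1[OF fin] unfolding B(4) by (rule exE)
  have "lin_indep_mod (cdim N) v {0}"
    unfolding lin_indep_mod_def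
  proof (intro allI impI ballI)
    fix \<alpha> j assume *: "(\<Sum>j\<in>{1..cdim N}. \<alpha> j *\<^sub>C v j) \<in> {0}" and j: "j \<in> {1..cdim N}"
    let ?f = "\<lambda>x. \<alpha> (the_inv_into {1..cdim N} v x)"
    have inv: "the_inv_into {1..cdim N} v (v i) = i" if "i \<in> {1..cdim N}" for i
      using v that by (simp add: bij_betw_def the_inv_into_f_f)
    have "(\<Sum>x\<in>B. ?f x *\<^sub>C x) = (\<Sum>j\<in>{1..cdim N}. ?f (v j) *\<^sub>C v j)"
      by (rule sum.reindex_bij_betw[OF v, symmetric])
    also have "\<dots> = (\<Sum>j\<in>{1..cdim N}. \<alpha> j *\<^sub>C v j)"
      by (intro sum.cong) (simp_all only: inv)
    also have "\<dots> = 0" using * by (rule singletonD)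
    finally have "(\<Sum>x\<in>B. ?f x *\<^sub>C x) = 0" .
    moreover have "v j \<in> B" using bij_betwE[OF v] j by (rule bspec)
    ultimately have "?f (v j) = 0"
      by (rule complex_vector.independentD[OF B(2) fin order_refl])
    then show "\<alpha> j = 0" unfolding inv[OF j] .
  qed
  then show thesis using that[of v] B(1,3) bij_betw_imp_surj_on[OF v] by simp
qed

text \<open>A vector outside the span would enlarge the independent family to
  \<open>Suc (cdim N)\<close> vectors inside a space spanned by \<open>cdim N\<close> of them. This
  is the dimension count behind the surjectivity of the adjoint plus c on the boundary span.\<close>

lemma family_spans:
  assumes "cfinite_dim N" "p ` {1..cdim N} \<subseteq> N" "lin_indep_mod (cdim N) p {0}"
  shows "N \<subseteq> cspan (p ` {1..cdim N})"
proof (rule subsetI, rule ccontr)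
  fix x assume x: "x \<in> N" "x \<notin> cspan (p ` {1..cdim N})"
  obtain v where v: "N \<subseteq> cspan (v ` {1..cdim N})"
    by (rule family_basis_exists[OF assms(1)])
  have "complex_vector.independent (insert x (p ` {1..cdim N}))"
    using x(2) lin_indep_mod_zero(2)[OF assms(3)] by (rule complex_vector.independent_insertI)
  moreover have "insert x (p ` {1..cdim N}) \<subseteq> cspan (v ` {1..cdim N})"
    using subset_trans[OF assms(2) v] subsetD[OF v x(1)] by (rule insert_subsetI[rotated])
  ultimately have "card (insert x (p ` {1..cdim N})) \<le> card (v ` {1..cdim N})"
    using complex_vector.independent_span_bound[OF finite_imageI[OF finite_atLeastAtMost]] by metis
  also have "\<dots> \<le> cdim N" using card_image_le[of "{1..cdim N}" v] by simp
  finally have "card (insert x (p ` {1..cdim N})) \<le> cdim N" .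
  moreover have "x \<notin> p ` {1..cdim N}"
    using x(2) complex_vector.span_base[of x "p ` {1..cdim N}"] by argo
  then have "card (insert x (p ` {1..cdim N})) = Suc (card (p ` {1..cdim N}))"
    by (intro card_insert_disjoint) simp_all
  moreover have "card (p ` {1..cdim N}) = cdim N"
    using card_image[OF lin_indep_mod_zero(1)[OF assms(3)]] by simp
  ultimately show False by linarith
qed


section \<open>Adjoints of unbounded operators\<close>

lemma dom_op_on [simp]: "dom (op_on D f) = D"
  unfolding op_on_def by (simp add: set_eq_iff domIff)

lemma the_op_on [simp]: "x \<in> D \<Longrightarrow> the (op_on D f x) = f x"
  by (simp add: op_on_def)

lemma map_le_iff_the: "S \<subseteq>\<^sub>m T \<longleftrightarrow> dom S \<subseteq> dom T \<and> (\<forall>x\<in>dom S. the (S x) = the (T x))"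
proof
  assume le: "S \<subseteq>\<^sub>m T"
  have "the (S x) = the (T x)" if "x \<in> dom S" for x
    using le that unfolding map_le_def by metis
  then show "dom S \<subseteq> dom T \<and> (\<forall>x\<in>dom S. the (S x) = the (T x))"
    using map_le_implies_dom_le[OF le] by blast
next
  assume *: "dom S \<subseteq> dom T \<and> (\<forall>x\<in>dom S. the (S x) = the (T x))"
  show "S \<subseteq>\<^sub>m T"
    unfolding map_le_def
  proof
    fix x assume x: "x \<in> dom S"
    then have "x \<in> dom T" "the (S x) = the (T x)" using * by blast+
    moreover obtain y z where "S x = Some y" "T x = Some z"
      using \<open>x \<in> dom T\<close> x by blast
    ultimately show "S x = T x" by simp
  qed
qed

lemma operator_eqI:
  assumes "dom S = dom T" "\<And>x. x \<in> dom S \<Longrightarrow> the (S x) = the (T x)"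
  shows "S = T"
  by (rule map_le_antisym) (simp_all add: map_le_iff_the assms)

lemma
  assumes "linear_operator T"
  shows linear_operator_subspace: "csubspace (dom T)"
    and linear_operator_add: "x \<in> dom T \<Longrightarrow> y \<in> dom T \<Longrightarrow> the (T (x + y)) = the (T x) + the (T y)"
    and linear_operator_scale: "x \<in> dom T \<Longrightarrow> the (T (c *\<^sub>C x)) = c *\<^sub>C the (T x)"
  using assms unfolding linear_operator_def by auto

lemma linear_operator_zero: "linear_operator T \<Longrightarrow> the (T 0) = 0"
  using linear_operator_scale[of T 0 0] complex_vector.subspace_0[OF linear_operator_subspace[of T]]
  by simp

lemma linear_operator_diff:
  assumes "linear_operator T" "x \<in> dom T" "y \<in> dom T"
  shows "the (T (x - y)) = the (T x) - the (T y)"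
proof -
  have "x - y \<in> dom T"
    by (intro complex_vector.subspace_diff linear_operator_subspace assms)
  then have "the (T x) = the (T (x - y)) + the (T y)"
    using linear_operator_add[OF assms(1), of "x - y" y] assms(3) by simp
  then show ?thesis by simp
qed

lemma linear_operator_sum:
  assumes "linear_operator T" "\<And>j. j \<in> A \<Longrightarrow> v j \<in> dom T"
  shows "(\<Sum>j\<in>A. \<alpha> j *\<^sub>C v j) \<in> dom T"
    and "the (T (\<Sum>j\<in>A. \<alpha> j *\<^sub>C v j)) = (\<Sum>j\<in>A. \<alpha> j *\<^sub>C the (T (v j)))"
proof -
  note sub = linear_operator_subspace[OF assms(1)]
  have "(\<Sum>j\<in>A. \<alpha> j *\<^sub>C v j) \<in> dom T \<and>
      the (T (\<Sum>j\<in>A. \<alpha> j *\<^sub>C v j)) = (\<Sum>j\<in>A. \<alpha> j *\<^sub>C the (T (v j)))"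
    using assms(2)
  proof (induction A rule: infinite_finite_induct)
    case (insert a A)
    then have "\<alpha> a *\<^sub>C v a \<in> dom T" "(\<Sum>j\<in>A. \<alpha> j *\<^sub>C v j) \<in> dom T"
      using complex_vector.subspace_scale[OF sub] by auto
    then show ?case
      using insert linear_operator_add[OF assms(1)] linear_operator_scale[OF assms(1)]
        complex_vector.subspace_add[OF sub] by simp
  qed (auto simp: linear_operator_zero[OF assms(1)] complex_vector.subspace_0[OF sub])
  then show "(\<Sum>j\<in>A. \<alpha> j *\<^sub>C v j) \<in> dom T"
    and "the (T (\<Sum>j\<in>A. \<alpha> j *\<^sub>C v j)) = (\<Sum>j\<in>A. \<alpha> j *\<^sub>C the (T (v j)))"
    by blast+
qed

lemma linear_operator_restrict:
  assumes "linear_operator T" "csubspace D" "D \<subseteq> dom T"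
  shows "linear_operator (op_on D (\<lambda>x. the (T x)))"
  using assms complex_vector.subspace_add[OF assms(2)] complex_vector.subspace_scale[OF assms(2)]
  unfolding linear_operator_def by (auto simp: subset_iff)

text \<open>Closed operators enter through their graphs as closed subspaces, the setting of the
  projection theorem.\<close>

lemma csubspace_graph:
  assumes "linear_operator T"
  shows "csubspace (Map.graph T)"
proof -
  note sub = linear_operator_subspace[OF assms]
  have eq: "Map.graph T = {z. fst z \<in> dom T \<and> snd z = the (T (fst z))}"
    unfolding graph_eq_to_snd_dom by (auto simp: image_iff prod_eq_iff)
  show ?thesis
    unfolding eq
    by (rule complex_vector.subspaceI)
      (simp_all add: scaleC_prod_def complex_vector.subspace_0[OF sub]
        complex_vector.subspace_add[OF sub] complex_vector.subspace_scale[OF sub]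
        linear_operator_zero[OF assms] linear_operator_add[OF assms]
        linear_operator_scale[OF assms])
qed

section \<open>The adjoint of a densely defined operator\<close>

lemma op_adjoint_eq_Some_iff:
  assumes "densely_defined T"
  shows "op_adjoint T y = Some z \<longleftrightarrow> (\<forall>x\<in>dom T. cinner (the (T x)) y = cinner x z)"
proof
  assume *: "op_adjoint T y = Some z"
  then obtain z' where z': "\<forall>x\<in>dom T. cinner (the (T x)) y = cinner x z'"
    by (auto simp: op_adjoint_def op_on_def split: if_splits)
  then have "op_adjoint T y = Some z'" using op_adjoint_eqI[OF assms] by blast
  then show "\<forall>x\<in>dom T. cinner (the (T x)) y = cinner x z" using * z' by simp
next
  assume "\<forall>x\<in>dom T. cinner (the (T x)) y = cinner x z"
  then show "op_adjoint T y = Some z" using op_adjoint_eqI[OF assms] by blast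
qed

lemma op_adjoint_cinner:
  assumes "densely_defined T" "x \<in> dom T" "y \<in> dom (op_adjoint T)"
  shows "cinner (the (T x)) y = cinner x (the (op_adjoint T y))"
  using assms op_adjoint_eq_Some_iff[OF assms(1)] by fastforce

lemma op_adjoint_memI:
  assumes "densely_defined T" "\<And>x. x \<in> dom T \<Longrightarrow> cinner (the (T x)) y = cinner x z"
  shows "y \<in> dom (op_adjoint T)" and "the (op_adjoint T y) = z"
  using op_adjoint_eqI[OF assms] by auto

lemma linear_operator_adjoint:
  assumes dd: "densely_defined T"
  shows "linear_operator (op_adjoint T)"
proof -
  note adj = op_adjoint_cinner[OF dd]
  have "0 \<in> dom (op_adjoint T)"
    by (rule op_adjoint_memI(1)[OF dd, of _ 0]) simp
  moreover have "x + y \<in> dom (op_adjoint T) \<and>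
      the (op_adjoint T (x + y)) = the (op_adjoint T x) + the (op_adjoint T y)"
    if "x \<in> dom (op_adjoint T)" "y \<in> dom (op_adjoint T)" for x y
  proof -
    have "cinner (the (T u)) (x + y) = cinner u (the (op_adjoint T x) + the (op_adjoint T y))"
      if "u \<in> dom T" for u
      using adj[OF that] \<open>x \<in> _\<close> \<open>y \<in> _\<close> by (simp add: cinner_add_right)
    from op_adjoint_memI[OF dd this] show ?thesis by blast
  qed
  moreover have "c *\<^sub>C x \<in> dom (op_adjoint T) \<and>
      the (op_adjoint T (c *\<^sub>C x)) = c *\<^sub>C the (op_adjoint T x)"
    if "x \<in> dom (op_adjoint T)" for c x
  proof -
    have "cinner (the (T u)) (c *\<^sub>C x) = cinner u (c *\<^sub>C the (op_adjoint T x))"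
      if "u \<in> dom T" for u
      using adj[OF that] \<open>x \<in> _\<close> by (simp add: cinner_scaleC_right)
    from op_adjoint_memI[OF dd this] show ?thesis by blast
  qed
  ultimately show ?thesis
    unfolding linear_operator_def complex_vector.subspace_def by blast
qed

text \<open>Each x in \<open>dom T\<close> imposes one closed condition on a pair, and the graph of
  the adjoint is the intersection of these conditions.\<close>

lemma closed_operator_adjoint:
  assumes dd: "densely_defined T"
  shows "closed_operator (op_adjoint T)"
proof -
  have "Map.graph (op_adjoint T) =
      (\<Inter>x\<in>dom T. {p. cinner (the (T x)) (fst p) = cinner x (snd p)})"
    using op_adjoint_eq_Some_iff[OF dd] by (fastforce simp: Map.graph_def)
  moreover have "closed {p. cinner (the (T x)) (fst p) = cinner x (snd p)}" for x
    by (intro closed_Collect_eq continuous_intros)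
  ultimately show ?thesis unfolding closed_operator_def by (simp add: closed_INT)
qed

lemma densely_defined_mono:
  assumes "densely_defined S" "dom S \<subseteq> dom T"
  shows "densely_defined T"
  using assms closure_mono unfolding densely_defined_def by blast

lemma op_adjoint_antimono:
  assumes "densely_defined S" "S \<subseteq>\<^sub>m T"
  shows "op_adjoint T \<subseteq>\<^sub>m op_adjoint S"
proof -
  have dd: "densely_defined T"
    using densely_defined_mono[OF assms(1) map_le_implies_dom_le[OF assms(2)]] .
  have "op_adjoint S y = Some z" if "op_adjoint T y = Some z" for y z
  proof -
    have "cinner (the (S x)) y = cinner x z" if "x \<in> dom S" for x
    proof -
      have "x \<in> dom T" "the (S x) = the (T x)"
        using assms(2) \<open>x \<in> dom S\<close> unfolding map_le_iff_the by auto
      then show ?thesis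
        using \<open>op_adjoint T y = Some z\<close> unfolding op_adjoint_eq_Some_iff[OF dd] by metis
    qed
    then show ?thesis unfolding op_adjoint_eq_Some_iff[OF assms(1)] by blast
  qed
  then show ?thesis by (fastforce simp: map_le_def)
qed

section \<open>Symmetric and self-adjoint operators and the double adjoint\<close>

lemma
  assumes "symmetric_operator S"
  shows symmetric_linear: "linear_operator S"
    and symmetric_dense: "densely_defined S"
    and symmetric_le_adjoint: "S \<subseteq>\<^sub>m op_adjoint S"
proof -
  show "linear_operator S" and dd: "densely_defined S"
    using assms unfolding symmetric_operator_def by auto
  have "op_adjoint S y = S y" if "y \<in> dom S" for y
    using assms that op_adjoint_eqI[OF dd, of y "the (S y)"] unfolding symmetric_operator_def
    by auto
  then show "S \<subseteq>\<^sub>m op_adjoint S" by (simp add: map_le_def)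
qed

lemma
  assumes "self_adjoint T"
  shows self_adjoint_symmetric: "symmetric_operator T"
    and self_adjoint_closed: "closed_operator T"
    and self_adjoint_eq: "op_adjoint T = T"
proof -
  show eq: "op_adjoint T = T" using assms unfolding self_adjoint_def by blast
  have dd: "densely_defined T" using assms unfolding self_adjoint_def by blast
  show "symmetric_operator T"
    using assms op_adjoint_cinner[OF dd] eq unfolding self_adjoint_def symmetric_operator_def by auto
  show "closed_operator T" using closed_operator_adjoint[OF dd] eq by simp
qed

text \<open>Project a pair (y, z) of the graph of the double adjoint onto the closed graph of S. The
  remainder (u, v) is orthogonal to that graph, which says that the adjoint maps v to -u. Since (u,
  v) also lies in the graph of the double adjoint, pairing with v gives -|u|^2 = |v|^2. Symmetry
  serves to make the adjoint densely defined.\<close>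

lemma double_adjoint:
  fixes S :: "('a::chilbert_space, 'a) operator"
  assumes closed: "closed_operator S" and sym: "symmetric_operator S"
  shows "op_adjoint (op_adjoint S) = S"
proof -
  note dd = symmetric_dense[OF sym]
  have le: "dom S \<subseteq> dom (op_adjoint S)"
    using symmetric_le_adjoint[OF sym] by (simp add: map_le_iff_the)
  have dd': "densely_defined (op_adjoint S)" by (rule densely_defined_mono[OF dd le])
  have "S y = Some z" if *: "op_adjoint (op_adjoint S) y = Some z" for y z
  proof -
    obtain p where p: "p \<in> Map.graph S" and orth: "\<And>q. q \<in> Map.graph S \<Longrightarrow> cinner q ((y, z) - p) = 0"
      using orthogonal_projection_exists[of "Map.graph S" "(y, z)"] closed
        csubspace_graph[OF symmetric_linear[OF sym]]
      unfolding closed_operator_def by blast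
    obtain s where s: "s \<in> dom S" "p = (s, the (S s))"
      using p by (auto simp: graph_eq_to_snd_dom)
    define u v where uv: "u = y - s" "v = z - the (S s)"
    have "cinner (the (S x)) v = cinner x (- u)" if "x \<in> dom S" for x
      using orth[of "(x, the (S x))"] that
      by (simp add: graph_eq_to_snd_dom s(2) uv cinner_simps algebra_simps)
    from op_adjoint_memI[OF dd this]
    have v: "v \<in> dom (op_adjoint S)" "the (op_adjoint S v) = - u" by auto
    have "cinner (- u) y = cinner v z"
      using * v unfolding op_adjoint_eq_Some_iff[OF dd'] by force
    moreover have "cinner (- u) s = cinner v (the (S s))"
      using op_adjoint_cinner[OF dd s(1) v(1)] v(2) cinner_commute by metis
    ultimately have "cinner (- u) u = cinner v v"
      unfolding uv by (simp add: cinner_diff_right)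
    then have "cinner u u + cinner v v = 0"
      by (metis add.right_inverse cinner_minus_left)
    then have "complex_of_real ((norm u)\<^sup>2 + (norm v)\<^sup>2) = 0"
      by (simp only: cinner_self of_real_add)
    then have "(norm u)\<^sup>2 + (norm v)\<^sup>2 = 0" by (simp only: of_real_eq_0_iff)
    then have "u = 0" "v = 0" unfolding sum_power2_eq_zero_iff by simp_all
    then have "y = s" "z = the (S s)" using uv by simp_all
    then show ?thesis using s(1) by auto
  qed
  then have "op_adjoint (op_adjoint S) \<subseteq>\<^sub>m S"
    unfolding map_le_def by (metis domD)
  moreover have "S \<subseteq>\<^sub>m op_adjoint (op_adjoint S)"
    unfolding map_le_def
  proof
    fix y assume y: "y \<in> dom S"
    have "cinner (the (op_adjoint S x)) y = cinner x (the (S y))" if "x \<in> dom (op_adjoint S)" for x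
      using op_adjoint_cinner[OF dd y that] cinner_commute by metis
    then have "op_adjoint (op_adjoint S) y = Some (the (S y))" by (rule op_adjoint_eqI[OF dd'])
    then show "S y = op_adjoint (op_adjoint S) y" using y by auto
  qed
  ultimately show ?thesis by (rule map_le_antisym)
qed

section \<open>Self-adjoint extensions of abstract symmetric operators\<close>

lemma symmetric_range_norm:
  assumes sym: "symmetric_operator S" and c: "c \<in> {\<i>, - \<i>}" and x: "x \<in> dom S"
  shows "(norm (the (S x) + c *\<^sub>C x))\<^sup>2 = (norm (the (S x)))\<^sup>2 + (norm x)\<^sup>2"
proof -
  have "cinner (the (S x)) x = cinner x (the (S x))"
    using sym x unfolding symmetric_operator_def by blast
  \<comment> \<open>Both cross terms are multiples of the same number, with factors c and
    \<open>cnj c\<close>, and these cancel because c is purely imaginary.\<close>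
  then have "cinner (the (S x) + c *\<^sub>C x) (the (S x) + c *\<^sub>C x)
      = cinner (the (S x)) (the (S x)) + cinner x x"
    using c by (auto simp: cinner_simps algebra_simps)
  then have "complex_of_real ((norm (the (S x) + c *\<^sub>C x))\<^sup>2)
      = complex_of_real ((norm (the (S x)))\<^sup>2 + (norm x)\<^sup>2)"
    by (simp only: cinner_self of_real_add)
  then show ?thesis by (simp only: of_real_eq_iff)
qed

lemma symmetric_range_eq_zeroD:
  assumes "symmetric_operator S" "c \<in> {\<i>, - \<i>}" "x \<in> dom S" "the (S x) + c *\<^sub>C x = 0"
  shows "x = 0"
  using symmetric_range_norm[OF assms(1-3)] assms(4) by (simp add: sum_power2_eq_zero_iff)

text \<open>In general the complement of the range of S + c is the kernel of the adjoint plus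
  \<open>cnj c\<close>; for purely imaginary c this is the eigenspace for c itself.\<close>

lemma
  assumes dd: "densely_defined S"
  shows defect_space_subspace: "csubspace (defect_space S c)"
    and defect_space_orthogonal: "n \<in> defect_space S c \<Longrightarrow> s \<in> dom S \<Longrightarrow> c \<in> {\<i>, - \<i>} \<Longrightarrow>
      cinner (the (S s) + c *\<^sub>C s) n = 0"
proof -
  note lin = linear_operator_adjoint[OF dd]
  note sub = linear_operator_subspace[OF lin]
  show "csubspace (defect_space S c)"
    unfolding defect_space_def
    by (rule complex_vector.subspaceI)
      (auto simp: complex_vector.subspace_0[OF sub] complex_vector.subspace_add[OF sub]
        complex_vector.subspace_scale[OF sub] linear_operator_zero[OF lin]
        linear_operator_add[OF lin] linear_operator_scale[OF lin] scaleC_add_right scaleC_scaleC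
        mult.commute simp del: domIff)
  show "cinner (the (S s) + c *\<^sub>C s) n = 0"
    if "n \<in> defect_space S c" "s \<in> dom S" "c \<in> {\<i>, - \<i>}"
  proof -
    have "cinner (the (S s)) n = cinner s (c *\<^sub>C n)"
      using op_adjoint_cinner[OF dd that(2)] that(1) by (simp add: defect_space_def)
    then show ?thesis using that(3) by (auto simp: cinner_simps)
  qed
qed

text \<open>The range of S + c is complete, being the isometric image of the closed graph, so z can
  be projected onto it. Orthogonality of the remainder to the range is the adjoint relation with
  eigenvalue c.\<close>

lemma symmetric_range_decomposition:
  fixes S :: "('a::chilbert_space, 'a) operator"
  assumes closed: "closed_operator S" and sym: "symmetric_operator S" and c: "c \<in> {\<i>, - \<i>}"
  obtains s n where "s \<in> dom S" "n \<in> defect_space S c" "z = the (S s) + c *\<^sub>C s + n"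
proof -
  note dd = symmetric_dense[OF sym] and lin = symmetric_linear[OF sym]
  note sub = linear_operator_subspace[OF lin]
  \<comment> \<open>Acting on pairs turns the unbounded S + c into a bounded map; on the graph it
    preserves norms because the product norm is the graph norm.\<close>
  define f where "f p = snd p + c *\<^sub>C fst p" for p :: "'a \<times> 'a"
  have bl: "bounded_linear f"
    unfolding f_def
    by (intro bounded_linear_add bounded_linear_snd
        bounded_linear_compose[OF bounded_linear_scaleC bounded_linear_fst])
  let ?R = "f ` Map.graph S"
  have R: "?R = {the (S s) + c *\<^sub>C s | s. s \<in> dom S}"
    unfolding graph_eq_to_snd_dom image_image f_def by auto
  have "complete ?R"
  proof (rule complete_isometric_image[of 1])
    show "\<forall>p\<in>Map.graph S. 1 * norm p \<le> norm (f p)"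
    proof
      fix p assume "p \<in> Map.graph S"
      then obtain x where x: "x \<in> dom S" "p = (x, the (S x))" unfolding graph_eq_to_snd_dom by blast
      have "(norm (f p))\<^sup>2 = (norm p)\<^sup>2"
        using symmetric_range_norm[OF sym c x(1)] by (simp add: f_def x(2) norm_Pair)
      then have "norm (f p) = norm p" by (simp add: power2_eq_iff_nonneg)
      then show "1 * norm p \<le> norm (f p)" by simp
    qed
    show "complete (Map.graph S)" using closed by (simp add: closed_operator_def complete_eq_closed)
  qed (use bl csubspace_imp_subspace[OF csubspace_graph[OF lin]] in auto)
  then have "closed ?R" by (simp add: complete_eq_closed)
  moreover have "csubspace ?R"
    unfolding R
  proof (rule complex_vector.subspaceI)
    have "the (S 0) + c *\<^sub>C 0 = 0" using linear_operator_zero[OF lin] by simp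
    then show "0 \<in> {the (S s) + c *\<^sub>C s | s. s \<in> dom S}"
      using complex_vector.subspace_0[OF sub] by force
    show "x + y \<in> {the (S s) + c *\<^sub>C s | s. s \<in> dom S}"
      if xy: "x \<in> {the (S s) + c *\<^sub>C s | s. s \<in> dom S}"
        "y \<in> {the (S s) + c *\<^sub>C s | s. s \<in> dom S}" for x y
    proof -
      obtain s r where sr: "s \<in> dom S" "r \<in> dom S" "x = the (S s) + c *\<^sub>C s"
        "y = the (S r) + c *\<^sub>C r"
        using xy by blast
      then have "x + y = the (S (s + r)) + c *\<^sub>C (s + r)"
        unfolding linear_operator_add[OF lin sr(1,2)] scaleC_add_right by simp
      then show ?thesis using complex_vector.subspace_add[OF sub sr(1,2)] by blast
    qed
    show "b *\<^sub>C x \<in> {the (S s) + c *\<^sub>C s | s. s \<in> dom S}"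
      if x: "x \<in> {the (S s) + c *\<^sub>C s | s. s \<in> dom S}" for b x
    proof -
      obtain s where s: "s \<in> dom S" "x = the (S s) + c *\<^sub>C s" using x by blast
      then have "b *\<^sub>C x = the (S (b *\<^sub>C s)) + c *\<^sub>C (b *\<^sub>C s)"
        by (simp add: linear_operator_scale[OF lin s(1)] scaleC_add_right scaleC_scaleC mult.commute)
      then show ?thesis using complex_vector.subspace_scale[OF sub s(1)] by blast
    qed
  qed
  ultimately obtain r where r: "r \<in> ?R" "\<And>x. x \<in> ?R \<Longrightarrow> cinner x (z - r) = 0"
    using orthogonal_projection_exists[of ?R z] by metis
  obtain s where s: "s \<in> dom S" "r = the (S s) + c *\<^sub>C s" using r(1) R by auto
  have "cinner (the (S x)) (z - r) = cinner x (c *\<^sub>C (z - r))" if "x \<in> dom S" for x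
  proof -
    have "cinner (the (S x) + c *\<^sub>C x) (z - r) = 0" using r(2) R that by blast
    then have "cinner (the (S x)) (z - r) = - (c * cinner x (z - r))"
      by (simp only: cinner_add_left cinner_scaleC_left eq_neg_iff_add_eq_0)
    moreover have "cinner x (c *\<^sub>C (z - r)) = - (c * cinner x (z - r))"
      unfolding cinner_scaleC_right using c by auto
    ultimately show ?thesis by simp
  qed
  from op_adjoint_memI[OF dd this] have "z - r \<in> defect_space S c"
    by (simp add: defect_space_def)
  then show thesis using that[OF s(1), of "z - r"] s(2) by simp
qed

text \<open>For self-adjoint T a defect vector n satisfies T n = c n, and injectivity of T - c, the
  opposite sign, forces n = 0; the decomposition of z then has no defect part.\<close>

lemma self_adjoint_range:
  fixes T :: "('a::chilbert_space, 'a) operator"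
  assumes sa: "self_adjoint T" and c: "c \<in> {\<i>, - \<i>}"
  obtains x where "x \<in> dom T" "the (T x) + c *\<^sub>C x = z"
proof -
  note sym = self_adjoint_symmetric[OF sa]
  obtain s n where s: "s \<in> dom T" "n \<in> defect_space T c" "z = the (T s) + c *\<^sub>C s + n"
    using symmetric_range_decomposition[OF self_adjoint_closed[OF sa] sym c] .
  have n: "n \<in> dom T" "the (T n) = c *\<^sub>C n"
    using s(2) self_adjoint_eq[OF sa] by (auto simp: defect_space_def)
  then have "the (T n) + (- c) *\<^sub>C n = 0" by (simp add: complex_vector.scale_minus_left)
  moreover have "- c \<in> {\<i>, - \<i>}" using c by auto
  ultimately have "n = 0" using symmetric_range_eq_zeroD[OF sym _ n(1)] by blast
  then show thesis using that s by simp
qed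

section \<open>The boundary form and its annihilators\<close>

lemma bform_swap: "bform T y x = - cnj (bform T x y)"
  using cinner_commute[of y "the (T x)"] cinner_commute[of "the (T y)" x] by (simp add: bform_def)

lemma bform_eq_zero_swap: "bform T y x = 0 \<longleftrightarrow> bform T x y = 0"
  using bform_swap[of T y x] by simp

lemma
  assumes lin: "linear_operator T"
  shows csubspace_bform_left: "csubspace {x \<in> dom T. bform T x y = 0}"
    and csubspace_bform_right: "csubspace {x \<in> dom T. bform T y x = 0}"
proof -
  note sub = linear_operator_subspace[OF lin]
  show "csubspace {x \<in> dom T. bform T x y = 0}"
  proof (rule complex_vector.subspaceI)
    show "0 \<in> {x \<in> dom T. bform T x y = 0}"
      using complex_vector.subspace_0[OF sub] by (simp add: bform_def linear_operator_zero[OF lin])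
    show "x + x' \<in> {x \<in> dom T. bform T x y = 0}"
      if "x \<in> {x \<in> dom T. bform T x y = 0}" "x' \<in> {x \<in> dom T. bform T x y = 0}" for x x'
      using that complex_vector.subspace_add[OF sub, of x x']
      by (simp add: bform_def linear_operator_add[OF lin] cinner_add_left)
    show "a *\<^sub>C x \<in> {x \<in> dom T. bform T x y = 0}" if "x \<in> {x \<in> dom T. bform T x y = 0}" for a x
      using that complex_vector.subspace_scale[OF sub, of x a]
      by (simp add: bform_def linear_operator_scale[OF lin] cinner_scaleC_left)
  qed
  then show "csubspace {x \<in> dom T. bform T y x = 0}"
    by (simp add: bform_eq_zero_swap[of T y])
qed

text \<open>Vanishing passes from generators to the span one argument at a time, since the
  annihilator of a single vector is a subspace on either side.\<close>

lemma bform_zero_cspan: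
  assumes lin: "linear_operator T" and G: "G \<subseteq> dom T"
    and 0: "\<And>x y. x \<in> G \<Longrightarrow> y \<in> G \<Longrightarrow> bform T x y = 0"
    and "x \<in> cspan G" "y \<in> cspan G"
  shows "bform T x y = 0"
proof -
  have "cspan G \<subseteq> {x \<in> dom T. bform T x y = 0}" if "y \<in> G" for y
    using G 0 that by (intro complex_vector.span_minimal csubspace_bform_left[OF lin]) auto
  then have "cspan G \<subseteq> {y \<in> dom T. bform T x y = 0}"
    using G assms(4) by (intro complex_vector.span_minimal csubspace_bform_right[OF lin]) auto
  then show ?thesis using assms(5) by auto
qed

text \<open>On \<open>dom S\<close> the adjoint acts as S, so the vanishing is the defining relation
  of the adjoint. Hence the boundary form only sees vectors modulo \<open>dom S\<close>.\<close>

lemma bform_adjoint_symmetric: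
  assumes "symmetric_operator S" "x \<in> dom S" "y \<in> dom (op_adjoint S)"
  shows "bform (op_adjoint S) x y = 0" "bform (op_adjoint S) y x = 0"
proof -
  have "the (op_adjoint S x) = the (S x)"
    using symmetric_le_adjoint[OF assms(1)] assms(2) unfolding map_le_iff_the by simp
  then show "bform (op_adjoint S) x y = 0"
    using op_adjoint_cinner[OF symmetric_dense[OF assms(1)] assms(2,3)] by (simp add: bform_def)
  then show "bform (op_adjoint S) y x = 0" by (simp add: bform_eq_zero_swap)
qed

text \<open>
  Since \<open>T + i\<close> maps \<open>dom T\<close> onto the whole space and \<open>dom S\<close> onto the orthogonal complement of
  the defect space, the preimages of a basis of the defect space form a basis of \<open>dom T\<close>
  modulo \<open>dom S\<close>.
\<close>

theorem self_adjoint_extension_boundary_conditions: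
  fixes S T :: "('a::chilbert_space, 'a) operator"
  assumes closed: "closed_operator S" and sym: "symmetric_operator S"
    and fin: "cfinite_dim (defect_space S \<i>)"
    and sa: "self_adjoint T" and le: "S \<subseteq>\<^sub>m T"
  obtains v where "\<And>j. j \<in> {1..deficiency S} \<Longrightarrow> v j \<in> dom T"
    "lin_indep_mod (deficiency S) v (dom S)"
    "dom T = {z \<in> dom (op_adjoint S). \<forall>j\<in>{1..deficiency S}. bform (op_adjoint S) z (v j) = 0}"
proof -
  let ?A = "op_adjoint S" and ?d = "deficiency S" and ?N = "defect_space S \<i>"
  note dd = symmetric_dense[OF sym]
  note symT = self_adjoint_symmetric[OF sa]
  note linT = symmetric_linear[OF symT]
  note subT = linear_operator_subspace[OF linT]
  have TA: "dom T \<subseteq> dom ?A" "\<And>x. x \<in> dom T \<Longrightarrow> the (T x) = the (?A x)"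
    using op_adjoint_antimono[OF dd le] self_adjoint_eq[OF sa] unfolding map_le_iff_the by auto
  have ST: "dom S \<subseteq> dom T" "\<And>x. x \<in> dom S \<Longrightarrow> the (S x) = the (T x)"
    using le unfolding map_le_iff_the by auto
  obtain n where n: "n ` {1..?d} \<subseteq> ?N" "lin_indep_mod ?d n {0}" "?N \<subseteq> cspan (n ` {1..?d})"
    using family_basis_exists[OF fin] unfolding deficiency_def by blast
  have "\<exists>x. x \<in> dom T \<and> the (T x) + \<i> *\<^sub>C x = n j" for j
    using self_adjoint_range[OF sa, of \<i> "n j"] by blast
  then obtain v where v: "\<And>j. v j \<in> dom T" "\<And>j. the (T (v j)) + \<i> *\<^sub>C v j = n j"
    by metis
  have sum: "(\<Sum>j\<in>{1..?d}. \<alpha> j *\<^sub>C v j) \<in> dom T \<and>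
      the (T (\<Sum>j\<in>{1..?d}. \<alpha> j *\<^sub>C v j)) + \<i> *\<^sub>C (\<Sum>j\<in>{1..?d}. \<alpha> j *\<^sub>C v j)
      = (\<Sum>j\<in>{1..?d}. \<alpha> j *\<^sub>C n j)" for \<alpha>
    using linear_operator_sum[OF linT, of "{1..?d}" v \<alpha>] v
    by (simp add: v(2)[symmetric] scaleC_add_right sum.distrib complex_vector.scale_sum_right
        mult.commute)
  have indep: "lin_indep_mod ?d v (dom S)"
    unfolding lin_indep_mod_def
  proof (intro allI impI)
    fix \<alpha>
    let ?s = "\<Sum>j\<in>{1..?d}. \<alpha> j *\<^sub>C v j" and ?n = "\<Sum>j\<in>{1..?d}. \<alpha> j *\<^sub>C n j"
    assume s: "?s \<in> dom S"
    \<comment> \<open>The vector \<open>?n\<close> lies both in the range of S + \<i> and in the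
      defect space, which are orthogonal, so it vanishes.\<close>
    have eq: "the (S ?s) + \<i> *\<^sub>C ?s = ?n" using sum[of \<alpha>] ST(2)[OF s] by simp
    have "?n \<in> ?N"
      using n(1) by (intro complex_vector.subspace_sum complex_vector.subspace_scale
          defect_space_subspace[OF dd]) auto
    then have "cinner (the (S ?s) + \<i> *\<^sub>C ?s) ?n = 0"
      by (rule defect_space_orthogonal[OF dd _ s]) simp
    then have "?n \<in> {0}" unfolding eq by simp
    then show "\<forall>j\<in>{1..?d}. \<alpha> j = 0" using n(2) unfolding lin_indep_mod_def by blast
  qed
  have span: "dom T \<subseteq> cspan (dom S \<union> v ` {1..?d})"
  proof
    fix x assume x: "x \<in> dom T"
    obtain s m where s: "s \<in> dom S" "m \<in> ?N" "the (T x) + \<i> *\<^sub>C x = the (S s) + \<i> *\<^sub>C s + m"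
      using symmetric_range_decomposition[OF closed sym, of \<i>] by blast
    obtain \<alpha> where \<alpha>: "m = (\<Sum>j\<in>{1..?d}. \<alpha> j *\<^sub>C n j)"
      using cspan_familyE subsetD[OF n(3) s(2)] by metis
    let ?s = "\<Sum>j\<in>{1..?d}. \<alpha> j *\<^sub>C v j"
    have sT: "s \<in> dom T" using s(1) ST(1) by blast
    have xs: "x - s \<in> dom T" by (rule complex_vector.subspace_diff[OF subT x sT])
    \<comment> \<open>By construction T + \<i> sends this difference to zero, and T + \<i> is
      injective.\<close>
    have w: "x - s - ?s \<in> dom T" using sum by (intro complex_vector.subspace_diff[OF subT xs]) blast
    have "the (T (x - s - ?s)) = the (T x) - the (S s) - the (T ?s)"
      using conjunct1[OF sum] ST(2)[OF s(1)] by (simp add: linear_operator_diff[OF linT] xs x sT)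
    then have "the (T (x - s - ?s)) + \<i> *\<^sub>C (x - s - ?s)
        = (the (T x) + \<i> *\<^sub>C x) - (the (S s) + \<i> *\<^sub>C s) - (the (T ?s) + \<i> *\<^sub>C ?s)"
      by (simp add: complex_vector.scale_right_diff_distrib)
    also have "\<dots> = 0" unfolding conjunct2[OF sum] s(3) \<alpha> by simp
    finally have "x - s - ?s = 0" using symmetric_range_eq_zeroD[OF symT _ w, of \<i>] by simp
    then have "x = s + ?s" by (simp add: algebra_simps)
    also have "\<dots> \<in> cspan (dom S \<union> v ` {1..?d})"
      using s(1) by (intro complex_vector.span_add complex_vector.span_sum
          complex_vector.span_scale complex_vector.span_base) auto
    finally show "x \<in> cspan (dom S \<union> v ` {1..?d})" .
  qed
  have bT: "bform ?A x y = 0" if "x \<in> dom T" "y \<in> dom T" for x y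
    using that symT TA(2) unfolding bform_def symmetric_operator_def by simp
  \<comment> \<open>Such a z annihilates \<open>dom S\<close> and all \<open>v j\<close>, hence all
    of \<open>dom T\<close>; this places it in the domain of the adjoint of T, which is T.\<close>
  have "z \<in> dom T" if z: "z \<in> dom ?A" "\<forall>j\<in>{1..?d}. bform ?A z (v j) = 0" for z
  proof -
    have "dom S \<union> v ` {1..?d} \<subseteq> {x \<in> dom ?A. bform ?A x z = 0}"
    proof (rule Un_least)
      show "dom S \<subseteq> {x \<in> dom ?A. bform ?A x z = 0}"
        using bform_adjoint_symmetric(1)[OF sym _ z(1)] ST(1) TA(1) by blast
      show "v ` {1..?d} \<subseteq> {x \<in> dom ?A. bform ?A x z = 0}"
        using z(2) TA(1) v(1) unfolding bform_eq_zero_swap[of ?A _ z] by blast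
    qed
    then have "dom T \<subseteq> {x \<in> dom ?A. bform ?A x z = 0}"
      using span complex_vector.span_minimal csubspace_bform_left[OF linear_operator_adjoint[OF dd]]
      by (meson order_trans)
    then have "cinner (the (T x)) z = cinner x (the (?A z))" if "x \<in> dom T" for x
      using that TA(2) by (auto simp: bform_def)
    from op_adjoint_memI(1)[OF symmetric_dense[OF symT] this] show "z \<in> dom T"
      unfolding self_adjoint_eq[OF sa] .
  qed
  then have "dom T = {z \<in> dom ?A. \<forall>j\<in>{1..?d}. bform ?A z (v j) = 0}"
    using TA(1) bT v(1) by blast
  then show thesis using that v(1) indep by blast
qed

section \<open>Isotropic boundary vectors and the extensions they define\<close>

context
  fixes S :: "('a::chilbert_space, 'a) operator" and v :: "nat \<Rightarrow> 'a"
  assumes closed: "closed_operator S" and sym: "symmetric_operator S"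
    and deficiency: "equal_finite_deficiency S"
    and v: "\<And>j. j \<in> {1..deficiency S} \<Longrightarrow> v j \<in> dom (op_adjoint S)"
    and indep: "lin_indep_mod (deficiency S) v (dom S)"
    and isotropic: "\<And>j k. j \<in> {1..deficiency S} \<Longrightarrow> k \<in> {1..deficiency S} \<Longrightarrow>
      bform (op_adjoint S) (v j) (v k) = 0"
begin

lemma boundary_span_isotropic:
  assumes "x \<in> cspan (dom S \<union> v ` {1..deficiency S})"
    and "y \<in> cspan (dom S \<union> v ` {1..deficiency S})"
  shows "bform (op_adjoint S) x y = 0"
proof (rule bform_zero_cspan[OF _ _ _ assms])
  note dom = map_le_implies_dom_le[OF symmetric_le_adjoint[OF sym]]
  show "linear_operator (op_adjoint S)"
    by (rule linear_operator_adjoint[OF symmetric_dense[OF sym]])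
  show G: "dom S \<union> v ` {1..deficiency S} \<subseteq> dom (op_adjoint S)" using dom v by blast
  show "bform (op_adjoint S) x y = 0"
    if x: "x \<in> dom S \<union> v ` {1..deficiency S}" and y: "y \<in> dom S \<union> v ` {1..deficiency S}" for x y
  proof -
    consider "x \<in> dom S" | "y \<in> dom S" | j k where "j \<in> {1..deficiency S}" "k \<in> {1..deficiency S}"
      "x = v j" "y = v k"
      using x y by blast
    then show ?thesis
      using bform_adjoint_symmetric[OF sym] isotropic subsetD[OF G x] subsetD[OF G y] by cases auto
  qed
qed

lemma boundary_span_dom: "cspan (dom S \<union> v ` {1..deficiency S}) \<subseteq> dom (op_adjoint S)"
  by (intro complex_vector.span_minimal Un_least image_subsetI v
      map_le_implies_dom_le[OF symmetric_le_adjoint[OF sym]]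
      linear_operator_subspace[OF linear_operator_adjoint[OF symmetric_dense[OF sym]]])

text \<open>
  The defect components of the vectors \<open>(S\<^sup>* + c) v\<^sub>j\<close> are linearly independent, hence by
  counting they span the defect space, which \<open>S + c\<close> misses.
\<close>

lemma boundary_span_range:
  assumes c: "c \<in> {\<i>, - \<i>}"
  obtains x where "x \<in> cspan (dom S \<union> v ` {1..deficiency S})"
    "the (op_adjoint S x) + c *\<^sub>C x = z"
proof -
  let ?A = "op_adjoint S" and ?d = "deficiency S" and ?N = "defect_space S c"
  let ?L = "cspan (dom S \<union> v ` {1..?d})"
  note dd = symmetric_dense[OF sym] and lin = symmetric_linear[OF sym]
  note linA = linear_operator_adjoint[OF dd]
  note subA = linear_operator_subspace[OF linA]
  have fin: "cfinite_dim ?N" and d: "cdim ?N = ?d"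
    using deficiency c unfolding equal_finite_deficiency_def deficiency_def by auto
  have SA: "dom S \<subseteq> dom ?A" "\<And>x. x \<in> dom S \<Longrightarrow> the (S x) = the (?A x)"
    using symmetric_le_adjoint[OF sym] unfolding map_le_iff_the by auto
  have "\<exists>s p. s \<in> dom S \<and> p \<in> ?N \<and> the (?A (v j)) + c *\<^sub>C v j = the (S s) + c *\<^sub>C s + p" for j
    using symmetric_range_decomposition[OF closed sym c] by metis
  then obtain s p where s: "\<And>j. s j \<in> dom S" and p: "\<And>j. p j \<in> ?N"
    and sp: "\<And>j. the (?A (v j)) + c *\<^sub>C v j = the (S (s j)) + c *\<^sub>C s j + p j"
    by metis
  \<comment> \<open>Subtracting the \<open>s j\<close> leaves vectors of the span that the adjoint
    plus c maps exactly onto the defect components \<open>p j\<close>.\<close>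
  define w where "w \<alpha> = (\<Sum>j\<in>{1..?d}. \<alpha> j *\<^sub>C (v j - s j))" for \<alpha>
  have w_eq: "w \<alpha> = (\<Sum>j\<in>{1..?d}. \<alpha> j *\<^sub>C v j) - (\<Sum>j\<in>{1..?d}. \<alpha> j *\<^sub>C s j)" for \<alpha>
    unfolding w_def by (simp add: complex_vector.scale_right_diff_distrib sum_subtractf)
  have wL: "w \<alpha> \<in> ?L" for \<alpha>
    unfolding w_def using s
    by (intro complex_vector.span_sum complex_vector.span_scale complex_vector.span_diff
        complex_vector.span_base) auto
  have Aw: "the (?A (w \<alpha>)) + c *\<^sub>C w \<alpha> = (\<Sum>j\<in>{1..?d}. \<alpha> j *\<^sub>C p j)" for \<alpha>
  proof -
    have vs: "v j - s j \<in> dom ?A" "the (?A (v j - s j)) + c *\<^sub>C (v j - s j) = p j"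
      if "j \<in> {1..?d}" for j
    proof -
      have "s j \<in> dom ?A" using s SA(1) by blast
      note this [simp] and v[OF that, simp]
      show "v j - s j \<in> dom ?A" by (rule complex_vector.subspace_diff[OF subA]) simp_all
      show "the (?A (v j - s j)) + c *\<^sub>C (v j - s j) = p j"
        using sp[of j] SA(2)[OF s[of j]]
        by (simp add: linear_operator_diff[OF linA] complex_vector.scale_right_diff_distrib
            algebra_simps)
    qed
    have Aw_sum: "the (?A (w \<alpha>)) = (\<Sum>j\<in>{1..?d}. \<alpha> j *\<^sub>C the (?A (v j - s j)))"
      unfolding w_def by (rule linear_operator_sum(2)[OF linA]) (rule vs(1))
    have "the (?A (w \<alpha>)) + c *\<^sub>C w \<alpha>
        = (\<Sum>j\<in>{1..?d}. \<alpha> j *\<^sub>C (the (?A (v j - s j)) + c *\<^sub>C (v j - s j)))"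
      unfolding Aw_sum unfolding w_def
      by (simp add: scaleC_add_right sum.distrib complex_vector.scale_sum_right mult.commute)
    also have "\<dots> = (\<Sum>j\<in>{1..?d}. \<alpha> j *\<^sub>C p j)"
      by (intro sum.cong refl) (simp only: vs(2))
    finally show ?thesis .
  qed
  have "lin_indep_mod ?d p {0}"
    unfolding lin_indep_mod_def
  proof (intro allI impI)
    fix \<alpha> assume "(\<Sum>j\<in>{1..?d}. \<alpha> j *\<^sub>C p j) \<in> {0}"
    \<comment> \<open>With this relation the form of \<open>w \<alpha>\<close> with itself is -2 c
      |w|^2. Isotropy gives w = 0, so the combination of the \<open>v j\<close> falls into
      \<open>dom S\<close>.\<close>
    then have "the (?A (w \<alpha>)) = - (c *\<^sub>C w \<alpha>)"
      using Aw[of \<alpha>] by (simp add: eq_neg_iff_add_eq_0)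
    then have "cinner (w \<alpha>) (w \<alpha>) = 0"
      using boundary_span_isotropic[OF wL wL, of \<alpha> \<alpha>] c by (auto simp: bform_def cinner_simps)
    then have "(\<Sum>j\<in>{1..?d}. \<alpha> j *\<^sub>C v j) = (\<Sum>j\<in>{1..?d}. \<alpha> j *\<^sub>C s j)"
      using w_eq[of \<alpha>] by simp
    also have "\<dots> \<in> dom S" by (rule linear_operator_sum(1)[OF lin s])
    finally show "\<forall>j\<in>{1..?d}. \<alpha> j = 0" using indep unfolding lin_indep_mod_def by blast
  qed
  then have span: "?N \<subseteq> cspan (p ` {1..?d})"
    using family_spans[OF fin, of p] p unfolding d by blast
  obtain r n where r: "r \<in> dom S" "n \<in> ?N" "z = the (S r) + c *\<^sub>C r + n"
    using symmetric_range_decomposition[OF closed sym c] .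
  obtain \<alpha> where \<alpha>: "n = (\<Sum>j\<in>{1..?d}. \<alpha> j *\<^sub>C p j)"
    using cspan_familyE subsetD[OF span r(2)] by metis
  have "r + w \<alpha> \<in> ?L"
    using r(1) by (intro complex_vector.span_add wL complex_vector.span_base) blast
  moreover have "the (?A (r + w \<alpha>)) + c *\<^sub>C (r + w \<alpha>) = z"
  proof -
    have "the (?A (r + w \<alpha>)) = the (S r) + the (?A (w \<alpha>))"
      unfolding SA(2)[OF r(1)]
      by (rule linear_operator_add[OF linA subsetD[OF SA(1) r(1)] subsetD[OF boundary_span_dom wL]])
    then have "the (?A (r + w \<alpha>)) + c *\<^sub>C (r + w \<alpha>)
        = the (S r) + c *\<^sub>C r + (the (?A (w \<alpha>)) + c *\<^sub>C w \<alpha>)"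
      by (simp add: scaleC_add_right)
    then show ?thesis unfolding Aw r(3) \<alpha> .
  qed
  ultimately show thesis using that by blast
qed

text \<open>The span annihilates itself by isotropy. Conversely let y annihilate it. Surjectivity
  for \<i> supplies x in the span with y - x in the eigenspace of the adjoint for -\<i>, and
  surjectivity for -\<i> supplies u in the span that the adjoint minus \<i> sends to y - x. The form
  of u with y - x equals |y - x|^2, and it vanishes.\<close>

lemma boundary_conditions_eq_span:
  "{z \<in> dom (op_adjoint S). \<forall>j\<in>{1..deficiency S}. bform (op_adjoint S) z (v j) = 0}
    = cspan (dom S \<union> v ` {1..deficiency S})"
proof -
  let ?A = "op_adjoint S" and ?d = "deficiency S"
  let ?L = "cspan (dom S \<union> v ` {1..?d})"
  let ?D = "{z \<in> dom ?A. \<forall>j\<in>{1..?d}. bform ?A z (v j) = 0}"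
  note linA = linear_operator_adjoint[OF symmetric_dense[OF sym]]
  have "?L \<subseteq> ?D"
  proof
    fix x assume x: "x \<in> ?L"
    have "bform ?A x (v j) = 0" if "j \<in> {1..?d}" for j
      using that by (intro boundary_span_isotropic[OF x] complex_vector.span_base) blast
    then show "x \<in> ?D" using subsetD[OF boundary_span_dom x] by blast
  qed
  moreover have "y \<in> ?L" if y: "y \<in> ?D" for y
  proof -
    have yL: "bform ?A y u = 0" if "u \<in> ?L" for u
    proof -
      have yA: "y \<in> dom ?A" using y by blast
      have "?L \<subseteq> {u \<in> dom ?A. bform ?A y u = 0}"
      proof (intro complex_vector.span_minimal csubspace_bform_right[OF linA] Un_least)
        show "dom S \<subseteq> {u \<in> dom ?A. bform ?A y u = 0}"
          using bform_adjoint_symmetric(2)[OF sym _ yA]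
            map_le_implies_dom_le[OF symmetric_le_adjoint[OF sym]] by blast
        show "v ` {1..?d} \<subseteq> {u \<in> dom ?A. bform ?A y u = 0}" using y v by blast
      qed
      then show ?thesis using that by blast
    qed
    obtain x where x: "x \<in> ?L" "the (?A x) + \<i> *\<^sub>C x = the (?A y) + \<i> *\<^sub>C y"
      by (rule boundary_span_range[OF insertI1])
    have xy: "x \<in> dom ?A" "y \<in> dom ?A" using subsetD[OF boundary_span_dom x(1)] y by auto
    have Aw: "the (?A (y - x)) = - (\<i> *\<^sub>C (y - x))"
      using x(2) by (simp add: linear_operator_diff[OF linA xy(2,1)]
          complex_vector.scale_right_diff_distrib algebra_simps)
    obtain u where u: "u \<in> ?L" "the (?A u) + (- \<i>) *\<^sub>C u = y - x"
      by (rule boundary_span_range[OF insertI2[OF singletonI]])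
    have "bform ?A (y - x) u = bform ?A y u - bform ?A x u"
      by (simp add: bform_def linear_operator_diff[OF linA xy(2,1)] cinner_diff_left)
    then have "bform ?A u (y - x) = 0"
      using yL[OF u(1)] boundary_span_isotropic[OF x(1) u(1)] by (simp add: bform_eq_zero_swap)
    then have "cinner (the (?A u) + (- \<i>) *\<^sub>C u) (y - x) = 0"
      unfolding bform_def Aw by (simp add: cinner_simps algebra_simps)
    then have "y = x" unfolding u(2) by simp
    then show ?thesis using x(1) by simp
  qed
  ultimately show ?thesis by blast
qed

text \<open>Both descriptions of the domain are used: as a span it is isotropic, so the restriction
  is contained in its adjoint; as an annihilator it absorbs the domain of that adjoint, because the
  adjoint relation tested on the \<open>v j\<close> is the list of boundary conditions.\<close>

theorem boundary_conditions_self_adjoint: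
  defines "D \<equiv> {z \<in> dom (op_adjoint S).
    \<forall>j\<in>{1..deficiency S}. bform (op_adjoint S) z (v j) = 0}"
  shows "self_adjoint (op_on D (\<lambda>x. the (op_adjoint S x)))"
    and "S \<subseteq>\<^sub>m op_on D (\<lambda>x. the (op_adjoint S x))"
proof -
  let ?A = "op_adjoint S" and ?T = "op_on D (\<lambda>x. the (op_adjoint S x))"
  note dd = symmetric_dense[OF sym]
  have DL: "D = cspan (dom S \<union> v ` {1..deficiency S})"
    unfolding D_def by (rule boundary_conditions_eq_span)
  have SD: "dom S \<subseteq> D"
    unfolding DL by (rule order_trans[OF Un_upper1 complex_vector.span_superset])
  have DA: "D \<subseteq> dom ?A" unfolding D_def by blast
  show le: "S \<subseteq>\<^sub>m ?T"
    unfolding map_le_iff_the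
  proof (intro conjI ballI)
    show "dom S \<subseteq> dom ?T" using SD by simp
    fix x assume "x \<in> dom S"
    then show "the (S x) = the (?T x)"
      using subsetD[OF SD] symmetric_le_adjoint[OF sym] unfolding map_le_iff_the by simp
  qed
  have dT: "densely_defined ?T" by (rule densely_defined_mono[OF dd map_le_implies_dom_le[OF le]])
  have lin: "linear_operator ?T"
    by (rule linear_operator_restrict[OF linear_operator_adjoint[OF dd] _ DA])
      (simp add: DL complex_vector.subspace_span)
  have "op_adjoint ?T = ?T"
  proof (rule map_le_antisym)
    show "?T \<subseteq>\<^sub>m op_adjoint ?T"
      unfolding map_le_def
    proof
      fix y assume "y \<in> dom ?T"
      then have y: "y \<in> D" by simp
      have "cinner (the (?T x)) y = cinner x (the (?A y))" if "x \<in> dom ?T" for x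
        using boundary_span_isotropic[of x y] that y by (simp add: DL bform_def)
      from op_adjoint_eqI[OF dT this] show "?T y = op_adjoint ?T y" using y by (simp add: op_on_def)
    qed
    show "op_adjoint ?T \<subseteq>\<^sub>m ?T"
      unfolding map_le_def
    proof
      fix y assume y: "y \<in> dom (op_adjoint ?T)"
      have TA: "y \<in> dom ?A" "op_adjoint ?T y = ?A y"
        using map_le_implies_dom_le[OF op_adjoint_antimono[OF dd le]] op_adjoint_antimono[OF dd le] y
        unfolding map_le_def by auto
      have "bform ?A y (v j) = 0" if "j \<in> {1..deficiency S}" for j
      proof -
        have "v j \<in> D" unfolding DL using that by (intro complex_vector.span_base) blast
        then have "bform ?A (v j) y = 0"
          using op_adjoint_cinner[OF dT, of "v j" y] y TA(2) by (simp add: bform_def)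
        then show ?thesis by (simp add: bform_eq_zero_swap)
      qed
      then have "y \<in> D" using TA(1) unfolding D_def by blast
      then show "op_adjoint ?T y = ?T y" using TA by (auto simp: op_on_def)
    qed
  qed
  then show "self_adjoint ?T" using lin dT unfolding self_adjoint_def by blast
qed

end

section \<open>The extended operators\<close>

text \<open>\<open>m\<close> is a parameter tied to \<open>cdim\<close> by an equation, so that the
  index ranges inside \<open>Psi\<close> and \<open>Omega\<close> can be folded to it.\<close>

locale extended_operators =
  fixes T0 :: "('h::chilbert_space, 'h) operator"
    and B :: "'w::chilbert_space \<Rightarrow> 'w"
    and \<xi> :: "nat \<Rightarrow> 'w"
    and t :: "nat \<Rightarrow> 'h"
    and m :: nat
  assumes dim: "m = cdim (UNIV :: 'w set)"
    and closed: "closed_operator T0"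
    and sym: "symmetric_operator T0"
    and basis: "orthonormal_basis m \<xi>"
    and B_self_adjoint: "self_adjoint (op_on UNIV B)"
    and GKN: "partial_GKN_set T0 (op_adjoint T0) m t"
begin

abbreviation A :: "('h, 'h) operator" where "A \<equiv> op_adjoint T0"
abbreviation \<Omega> :: "'h \<Rightarrow> 'w" where "\<Omega> \<equiv> Omega A t \<xi>"
abbreviation S0 :: "('h \<times> 'w, 'h \<times> 'w) operator" where "S0 \<equiv> That0 T0 A t \<xi> B"
abbreviation S1 :: "('h \<times> 'w, 'h \<times> 'w) operator" where "S1 \<equiv> That1 A t \<xi> B"

lemmas dense = symmetric_dense[OF sym]
lemmas linear0 = symmetric_linear[OF sym]
lemmas subspace0 = linear_operator_subspace[OF linear0]
lemmas linear1 = linear_operator_adjoint[OF dense]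
lemmas subspace1 = linear_operator_subspace[OF linear1]
lemmas dom0_le_dom1 = map_le_implies_dom_le[OF symmetric_le_adjoint[OF sym]]

lemma Omega_eq: "\<Omega> x = (\<Sum>j\<in>{1..m}. bform A x (t j) *\<^sub>C \<xi> j)"
  unfolding Omega_def dim ..

lemma B_add: "B (a + b) = B a + B b"
  and B_scale: "B (c *\<^sub>C a) = c *\<^sub>C B a"
  and B_symmetric: "cinner (B a) b = cinner a (B b)"
proof -
  note B = self_adjoint_symmetric[OF B_self_adjoint]
  show "B (a + b) = B a + B b" using linear_operator_add[OF symmetric_linear[OF B], of a b] by simp
  show "B (c *\<^sub>C a) = c *\<^sub>C B a"
    using linear_operator_scale[OF symmetric_linear[OF B], of a c] by simp
  show "cinner (B a) b = cinner a (B b)" using B unfolding symmetric_operator_def by simp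
qed

lemma t_dom: "j \<in> {1..m} \<Longrightarrow> t j \<in> dom A"
  and t_indep: "lin_indep_mod m t (dom T0)"
  and t_isotropic: "i \<in> {1..m} \<Longrightarrow> j \<in> {1..m} \<Longrightarrow> bform A (t i) (t j) = 0"
  using GKN unfolding partial_GKN_set_def by blast+

section \<open>Coordinates in W, lifts to H, and their relation to \<Omega>\<close>

lemma cinner_basis_sum:
  assumes "k \<in> {1..m}"
  shows "cinner (\<Sum>j\<in>{1..m}. \<alpha> j *\<^sub>C \<xi> j) (\<xi> k) = \<alpha> k"
proof -
  have "cinner (\<Sum>j\<in>{1..m}. \<alpha> j *\<^sub>C \<xi> j) (\<xi> k) = (\<Sum>j\<in>{1..m}. if j = k then \<alpha> j else 0)"
    unfolding cinner_sum_left cinner_scaleC_left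
    using basis assms unfolding orthonormal_basis_def by (intro sum.cong refl) simp
  also have "\<dots> = \<alpha> k" using assms by simp
  finally show ?thesis .
qed

lemma basis_expansion: "(\<Sum>j\<in>{1..m}. cinner a (\<xi> j) *\<^sub>C \<xi> j) = a"
proof -
  have "a \<in> cspan (\<xi> ` {1..m})" using basis unfolding orthonormal_basis_def by simp
  then obtain \<alpha> where \<alpha>: "a = (\<Sum>j\<in>{1..m}. \<alpha> j *\<^sub>C \<xi> j)" by (rule cspan_familyE)
  have "cinner a (\<xi> j) = \<alpha> j" if "j \<in> {1..m}" for j
    unfolding \<alpha> by (rule cinner_basis_sum[OF that])
  then have "(\<Sum>j\<in>{1..m}. cinner a (\<xi> j) *\<^sub>C \<xi> j) = (\<Sum>j\<in>{1..m}. \<alpha> j *\<^sub>C \<xi> j)"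
    by (intro sum.cong refl) metis
  then show ?thesis unfolding \<alpha>[symmetric] .
qed

text \<open>The linear section of \<open>Psi\<close>: the vector in the span of the
  \<open>t j\<close> that \<open>Psi\<close> sends to \<open>a\<close>.\<close>

definition lift :: "'w \<Rightarrow> 'h" where "lift a = (\<Sum>j\<in>{1..m}. cinner a (\<xi> j) *\<^sub>C t j)"

lemma lift_add: "lift (a + b) = lift a + lift b"
  by (simp add: lift_def cinner_add_left scaleC_add_left sum.distrib)

lemma lift_scale: "lift (c *\<^sub>C a) = c *\<^sub>C lift a"
  by (simp add: lift_def cinner_scaleC_left complex_vector.scale_sum_right)

lemma lift_zero [simp]: "lift 0 = 0"
  by (simp add: lift_def)

lemma lift_dom: "lift a \<in> dom A"
  unfolding lift_def by (rule linear_operator_sum(1)[OF linear1 t_dom])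

lemma lift_cspan: "lift a \<in> cspan (t ` {1..m})"
  unfolding lift_def by (rule family_in_cspan)

text \<open>The form is conjugate-linear in its second argument, so the coordinates of b reappear
  conjugated as \<open>cinner (\<xi> j) b\<close>. Up to the boundary form, \<Omega> is thus the
  adjoint of \<open>lift\<close>.\<close>

lemma Omega_cinner:
  assumes "x \<in> dom A"
  shows "cinner (\<Omega> x) b = bform A x (lift b)"
proof -
  have "the (A (lift b)) = (\<Sum>j\<in>{1..m}. cinner b (\<xi> j) *\<^sub>C the (A (t j)))"
    unfolding lift_def by (rule linear_operator_sum(2)[OF linear1 t_dom])
  then have "bform A x (lift b) = (\<Sum>j\<in>{1..m}. cnj (cinner b (\<xi> j)) * bform A x (t j))"
    by (simp add: bform_def lift_def cinner_sum_right cinner_scaleC_right sum_subtractf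
        right_diff_distrib)
  also have "\<dots> = (\<Sum>j\<in>{1..m}. bform A x (t j) * cinner (\<xi> j) b)"
    by (intro sum.cong refl) (simp add: cinner_commute[of _ b])
  also have "\<dots> = cinner (\<Omega> x) b"
    by (simp add: Omega_eq cinner_sum_left cinner_scaleC_left)
  finally show ?thesis ..
qed

lemma Omega_add:
  assumes "x \<in> dom A" "y \<in> dom A"
  shows "\<Omega> (x + y) = \<Omega> x + \<Omega> y"
proof -
  have "bform A (x + y) z = bform A x z + bform A y z" for z
    unfolding bform_def linear_operator_add[OF linear1 assms] cinner_add_left by simp
  then show ?thesis by (simp add: Omega_eq scaleC_add_left sum.distrib)
qed

lemma Omega_scale:
  assumes "x \<in> dom A"
  shows "\<Omega> (c *\<^sub>C x) = c *\<^sub>C \<Omega> x"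
proof -
  have "bform A (c *\<^sub>C x) z = c * bform A x z" for z
    unfolding bform_def linear_operator_scale[OF linear1 assms] cinner_scaleC_left
    by (simp add: right_diff_distrib)
  then show ?thesis by (simp add: Omega_eq complex_vector.scale_sum_right)
qed

lemma isotropic:
  assumes "x \<in> cspan (dom T0 \<union> t ` {1..m})" "y \<in> cspan (dom T0 \<union> t ` {1..m})"
  shows "bform A x y = 0"
proof (rule bform_zero_cspan[OF linear1 _ _ assms])
  show G: "dom T0 \<union> t ` {1..m} \<subseteq> dom A" using dom0_le_dom1 t_dom by blast
  show "bform A x y = 0" if x: "x \<in> dom T0 \<union> t ` {1..m}" and y: "y \<in> dom T0 \<union> t ` {1..m}" for x y
  proof -
    consider "x \<in> dom T0" | "y \<in> dom T0" | i j where "i \<in> {1..m}" "j \<in> {1..m}" "x = t i" "y = t j"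
      using x y by blast
    then show ?thesis
      using bform_adjoint_symmetric[OF sym] t_isotropic subsetD[OF G x] subsetD[OF G y] by cases auto
  qed
qed

section \<open>Domains and action of the extended operators\<close>

lemma dom_That0: "dom S0 = {(x, a). x - lift a \<in> dom T0}"
proof -
  \<comment> \<open>Independence modulo \<open>dom T0\<close> makes the coefficients of the
    \<open>t j\<close> unique, so b is the value of \<open>Psi\<close> at y precisely when
    \<open>lift b\<close> is the part of y in their span. The resulting condition is jointly linear
    in y and b.\<close>
  have "(\<exists>x. (y, b) = (x, Psi T0 t \<xi> x) \<and> x \<in> Delta0 T0 m t) \<longleftrightarrow> y - lift b \<in> dom T0" for y b
  proof
    assume "\<exists>x. (y, b) = (x, Psi T0 t \<xi> x) \<and> x \<in> Delta0 T0 m t"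
    then obtain x0 s where *: "b = Psi T0 t \<xi> y" "y = x0 + s" "x0 \<in> dom T0" "s \<in> cspan (t ` {1..m})"
      unfolding Delta0_def by blast
    obtain \<alpha> where \<alpha>: "s = (\<Sum>j\<in>{1..m}. \<alpha> j *\<^sub>C t j)" using *(4) by (rule cspan_familyE)
    have b: "b = (\<Sum>j\<in>{1..m}. \<alpha> j *\<^sub>C \<xi> j)"
      unfolding *(1,2) \<alpha> by (rule Psi_eq[OF linear0, where \<xi> = \<xi>, folded dim, OF t_indep *(3)])
    have "cinner b (\<xi> j) = \<alpha> j" if "j \<in> {1..m}" for j
      unfolding b by (rule cinner_basis_sum[OF that])
    then have "lift b = s" unfolding lift_def \<alpha> by (intro sum.cong refl) metis
    then show "y - lift b \<in> dom T0" using *(2,3) by simp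
  next
    assume y: "y - lift b \<in> dom T0"
    have "Psi T0 t \<xi> (y - lift b + lift b) = b"
      using Psi_eq[OF linear0, where \<xi> = \<xi>, folded dim, OF t_indep y, of "\<lambda>j. cinner b (\<xi> j)"]
      unfolding lift_def[symmetric] basis_expansion .
    moreover have "y - lift b + lift b \<in> Delta0 T0 m t"
      unfolding Delta0_def using y lift_cspan by blast
    ultimately show "\<exists>x. (y, b) = (x, Psi T0 t \<xi> x) \<and> x \<in> Delta0 T0 m t" by auto
  qed
  then show ?thesis unfolding That0_def dom_op_on dim[symmetric] by blast
qed

lemma dom_That1: "dom S1 = dom A \<times> UNIV"
  unfolding That1_def dom_op_on by blast

lemma the_That1: "x \<in> dom A \<Longrightarrow> the (S1 (x, a)) = (the (A x), B a - \<Omega> x)"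
  unfolding That1_def by (subst the_op_on) auto

lemma That0_cspan: "(x, a) \<in> dom S0 \<Longrightarrow> x \<in> cspan (dom T0 \<union> t ` {1..m})"
proof -
  assume "(x, a) \<in> dom S0"
  then have "x - lift a \<in> cspan (dom T0 \<union> t ` {1..m})"
    unfolding dom_That0 by (auto intro: complex_vector.span_base)
  moreover have "lift a \<in> cspan (dom T0 \<union> t ` {1..m})"
    using lift_cspan complex_vector.span_mono[OF Un_upper2] by blast
  ultimately have "x - lift a + lift a \<in> cspan (dom T0 \<union> t ` {1..m})"
    by (rule complex_vector.span_add)
  then show ?thesis by simp
qed

lemma That0_dom1:
  assumes "(x, a) \<in> dom S0"
  shows "x \<in> dom A"
proof -
  have "x - lift a \<in> dom A" using assms dom0_le_dom1 unfolding dom_That0 by blast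
  then have "x - lift a + lift a \<in> dom A" by (rule complex_vector.subspace_add[OF subspace1 _ lift_dom])
  then show ?thesis by simp
qed

text \<open>The space spanned by \<open>dom T0\<close> and the \<open>t j\<close> is isotropic, so
  every coefficient of \<Omega> x vanishes. This is why the minimal operator, written without
  \<Omega>, is a restriction of the maximal one.\<close>

lemma That0_Omega:
  assumes "(x, a) \<in> dom S0"
  shows "\<Omega> x = 0"
proof -
  have "bform A x (t j) = 0" if "j \<in> {1..m}" for j
    using that by (intro isotropic[OF That0_cspan[OF assms]] complex_vector.span_base) blast
  then show ?thesis unfolding Omega_eq by (intro sum.neutral) simp
qed

lemma That0_le_That1: "S0 \<subseteq>\<^sub>m S1"
  unfolding map_le_iff_the
proof (intro conjI ballI)
  show "dom S0 \<subseteq> dom S1"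
    unfolding dom_That1 by (rule subrelI) (simp add: That0_dom1)
  fix z assume z: "z \<in> dom S0"
  obtain x a where xa: "z = (x, a)" by (rule prod.exhaust)
  have "the (S0 z) = (the (A x), B a)"
    using z unfolding That0_def dom_op_on xa by (subst the_op_on) auto
  also have "\<dots> = the (S1 z)"
    using z the_That1[OF That0_dom1] That0_Omega unfolding xa by simp
  finally show "the (S0 z) = the (S1 z)" .
qed

lemma That1_linear: "linear_operator S1"
proof -
  have "csubspace (dom S1)"
    unfolding dom_That1
    by (rule complex_vector.subspaceI)
      (use complex_vector.subspace_0[OF subspace1] complex_vector.subspace_add[OF subspace1]
        complex_vector.subspace_scale[OF subspace1]
       in \<open>simp_all add: mem_Times_iff scaleC_prod_def\<close>)
  moreover have "the (S1 (z + w)) = the (S1 z) + the (S1 w)" if zw: "z \<in> dom S1" "w \<in> dom S1" for z w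
  proof -
    obtain x a y b where eq: "z = (x, a)" "w = (y, b)" by (metis prod.exhaust)
    have xy: "x \<in> dom A" "y \<in> dom A" using zw unfolding eq dom_That1 by blast+
    show ?thesis
      unfolding eq add_Pair the_That1[OF xy(1)] the_That1[OF xy(2)]
        the_That1[OF complex_vector.subspace_add[OF subspace1 xy]]
        linear_operator_add[OF linear1 xy] Omega_add[OF xy] B_add
      by simp
  qed
  moreover have "the (S1 (c *\<^sub>C z)) = c *\<^sub>C the (S1 z)" if z: "z \<in> dom S1" for c z
  proof -
    obtain x a where eq: "z = (x, a)" by (metis prod.exhaust)
    have x: "x \<in> dom A" using z unfolding eq dom_That1 by blast
    show ?thesis
      unfolding eq scaleC_pair the_That1[OF x] the_That1[OF complex_vector.subspace_scale[OF subspace1 x]]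
        linear_operator_scale[OF linear1 x] Omega_scale[OF x] B_scale
        complex_vector.scale_right_diff_distrib ..
  qed
  ultimately show ?thesis unfolding linear_operator_def by blast
qed

text \<open>The two B terms cancel by symmetry, and -\<Omega> contributes the two mixed terms. This
  identification lets the abstract results on boundary forms apply.\<close>

lemma bform_That1:
  assumes "z \<in> dom S1" "w \<in> dom S1"
  shows "bform S1 z w = bform_hat A t \<xi> z w"
proof -
  obtain x a y b where eq: "z = (x, a)" "w = (y, b)" by (metis prod.exhaust)
  have xy: "x \<in> dom A" "y \<in> dom A" using assms unfolding eq dom_That1 by blast+
  show ?thesis
    unfolding eq bform_def[of S1] the_That1[OF xy(1)] the_That1[OF xy(2)]
    by (simp add: bform_hat_def bform_def cinner_diff_left cinner_diff_right B_symmetric)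
qed

text \<open>Since x - lift a lies in \<open>dom T0\<close>, only the form of \<open>lift a\<close>
  with y survives in the first component, and the term with \<Omega> y cancels it by skew symmetry;
  \<Omega> x is zero.\<close>

lemma bform_That0_That1:
  assumes "z \<in> dom S0" "w \<in> dom S1"
  shows "cinner (the (S0 z)) w = cinner z (the (S1 w))"
proof -
  obtain x a y b where eq: "z = (x, a)" "w = (y, b)" by (metis prod.exhaust)
  have y: "y \<in> dom A" using assms(2) unfolding eq dom_That1 by blast
  have x: "x \<in> dom A" "x - lift a \<in> dom T0"
    using assms(1) That0_dom1 unfolding eq dom_That0 by blast+
  have "bform A (x - lift a) y = 0" by (rule bform_adjoint_symmetric(1)[OF sym x(2) y])
  then have "bform A x y = bform A (lift a) y"
    by (simp add: bform_def linear_operator_diff[OF linear1 x(1) lift_dom] cinner_diff_left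
        algebra_simps)
  moreover have "cinner a (\<Omega> y) = - bform A (lift a) y"
    using Omega_cinner[OF y, of a] cinner_commute[of a "\<Omega> y"] bform_swap[of A "lift a" y] by simp
  ultimately have "bform_hat A t \<xi> z w = 0"
    using That0_Omega[of x a] assms(1) unfolding eq by (simp add: bform_hat_def)
  then have "bform S1 z w = 0"
    using bform_That1[OF _ assms(2), of z] map_le_implies_dom_le[OF That0_le_That1] assms(1) by auto
  then show ?thesis
    using That0_le_That1 assms(1) unfolding map_le_iff_the by (simp add: bform_def)
qed

section \<open>Density, symmetry and the two adjoints\<close>

lemma That0_dense: "densely_defined S0"
proof -
  have "(x, a) \<in> closure (dom S0)" for x a
    unfolding closure_approachable
  proof (intro allI impI)
    fix e :: real assume "0 < e"
    moreover have "x - lift a \<in> closure (dom T0)" using dense unfolding densely_defined_def by simp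
    ultimately obtain y where y: "y \<in> dom T0" "dist y (x - lift a) < e"
      unfolding closure_approachable by blast
    \<comment> \<open>The second component is hit exactly: density was applied to x - lift a, and
      the lift is now added back.\<close>
    have "(y + lift a, a) \<in> dom S0" using y(1) unfolding dom_That0 by simp
    moreover have "dist (y + lift a, a) (x, a) < e"
      using y(2) by (simp add: dist_Pair_Pair dist_norm algebra_simps)
    ultimately show "\<exists>z\<in>dom S0. dist z (x, a) < e" by blast
  qed
  then show ?thesis unfolding densely_defined_def by auto
qed

lemma That0_symmetric: "symmetric_operator S0"
proof -
  have le: "dom S0 \<subseteq> dom S1" "\<And>z. z \<in> dom S0 \<Longrightarrow> the (S0 z) = the (S1 z)"
    using That0_le_That1 unfolding map_le_iff_the by auto
  have "csubspace (dom S0)"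
  proof (rule complex_vector.subspaceI)
    show "0 \<in> dom S0"
      using complex_vector.subspace_0[OF subspace0] unfolding dom_That0 by (simp add: zero_prod_def)
    show "z + w \<in> dom S0" if zw: "z \<in> dom S0" "w \<in> dom S0" for z w
    proof -
      obtain x a y b where eq: "z = (x, a)" "w = (y, b)" by (metis prod.exhaust)
      have "x - lift a + (y - lift b) \<in> dom T0"
        using zw complex_vector.subspace_add[OF subspace0] unfolding eq dom_That0 by blast
      also have "x - lift a + (y - lift b) = x + y - lift (a + b)" by (simp add: lift_add)
      finally show ?thesis unfolding eq dom_That0 add_Pair by blast
    qed
    show "c *\<^sub>C z \<in> dom S0" if z: "z \<in> dom S0" for c z
    proof -
      obtain x a where eq: "z = (x, a)" by (metis prod.exhaust)
      have "c *\<^sub>C (x - lift a) \<in> dom T0"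
        using z complex_vector.subspace_scale[OF subspace0] unfolding eq dom_That0 by blast
      also have "c *\<^sub>C (x - lift a) = c *\<^sub>C x - lift (c *\<^sub>C a)"
        by (simp add: lift_scale complex_vector.scale_right_diff_distrib)
      finally show ?thesis unfolding eq dom_That0 scaleC_pair by blast
    qed
  qed
  from linear_operator_restrict[OF That1_linear this le(1)]
  have "linear_operator (op_on (dom S0) (\<lambda>z. the (S1 z)))" .
  also have "op_on (dom S0) (\<lambda>z. the (S1 z)) = S0"
    by (rule operator_eqI) (simp_all add: le(2))
  finally have "linear_operator S0" .
  moreover have "cinner (the (S0 z)) w = cinner z (the (S0 w))" if "z \<in> dom S0" "w \<in> dom S0" for z w
    unfolding le(2)[OF that(2)] by (rule bform_That0_That1[OF that(1) subsetD[OF le(1) that(2)]])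
  ultimately show ?thesis using That0_dense unfolding symmetric_operator_def by blast
qed

text \<open>One inclusion is the pairing identity. For the other, vectors (x, 0) with x in
  \<open>dom T0\<close> suffice: the minimal operator maps them to (T0 x, 0), so y lies in the
  domain of the adjoint of T0, and the maximal domain leaves the second component free.\<close>

lemma adjoint_That0: "op_adjoint S0 = S1"
proof -
  have eq: "op_adjoint S0 w = S1 w" if "w \<in> dom S1" for w
    using op_adjoint_eqI[OF That0_dense bform_That0_That1, of w] that by auto
  have "w \<in> dom S1" if "w \<in> dom (op_adjoint S0)" for w
  proof -
    obtain y b where w: "w = (y, b)" by (metis prod.exhaust)
    obtain z c where zc: "the (op_adjoint S0 w) = (z, c)" by (metis prod.exhaust)
    have "cinner (the (T0 x)) y = cinner x z" if x: "x \<in> dom T0" for x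
    proof -
      have x0: "(x, 0) \<in> dom S0" using x unfolding dom_That0 by simp
      have "the (S0 (x, 0)) = (the (A x), B 0 - \<Omega> x)"
        using That0_le_That1 x0 the_That1[OF That0_dom1[OF x0], of 0] unfolding map_le_iff_the by simp
      then have "the (S0 (x, 0)) = (the (T0 x), 0)"
        using symmetric_le_adjoint[OF sym] x That0_Omega[OF x0] B_scale[of 0 0]
        unfolding map_le_iff_the by simp
      then show ?thesis
        using op_adjoint_cinner[OF That0_dense x0 \<open>w \<in> dom (op_adjoint S0)\<close>] unfolding w[symmetric] zc
        by (simp add: w)
    qed
    from op_adjoint_memI(1)[OF dense this] show ?thesis unfolding w dom_That1 by blast
  qed
  then show ?thesis
    using eq by (intro map_le_antisym) (simp_all add: map_le_def del: domIff)
qed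

text \<open>Pairing with (x, 0) turns -\<Omega> x into a form with \<open>lift b\<close>, and the
  relation then places y - lift b in the domain of the double adjoint of T0. Closedness of T0
  identifies this with \<open>dom T0\<close>.\<close>

lemma adjoint_That1: "op_adjoint S1 = S0"
proof -
  have dd: "densely_defined S1"
    by (rule densely_defined_mono[OF That0_dense map_le_implies_dom_le[OF That0_le_That1]])
  have adj: "op_adjoint S1 w = S0 w" if w: "w \<in> dom S0" for w
  proof -
    have "cinner (the (S1 z)) w = cinner z (the (S0 w))" if "z \<in> dom S1" for z
      using bform_That0_That1[OF w that] cinner_commute by metis
    from op_adjoint_eqI[OF dd this] show ?thesis using w by auto
  qed
  have dom: "w \<in> dom S0" if w: "w \<in> dom (op_adjoint S1)" for w
  proof -
    obtain y b where yb: "w = (y, b)" by (metis prod.exhaust)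
    obtain z c where zc: "the (op_adjoint S1 w) = (z, c)" by (metis prod.exhaust)
    have "cinner (the (A x)) (y - lift b) = cinner x (z - the (A (lift b)))" if x: "x \<in> dom A" for x
    proof -
      have "(x, 0) \<in> dom S1" using x unfolding dom_That1 by blast
      from op_adjoint_cinner[OF dd this w]
      have "cinner (the (A x)) y - cinner (\<Omega> x) b = cinner x z"
        unfolding zc the_That1[OF x] unfolding yb using B_scale[of 0 0] by (simp add: cinner_minus_left)
      then show ?thesis
        unfolding Omega_cinner[OF x] by (simp add: bform_def cinner_diff_right algebra_simps)
    qed
    from op_adjoint_memI(1)[OF densely_defined_mono[OF dense dom0_le_dom1] this]
    have "y - lift b \<in> dom T0" unfolding double_adjoint[OF closed sym] .
    then show ?thesis unfolding yb dom_That0 by blast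
  qed
  show ?thesis
    using adj dom by (intro map_le_antisym) (simp_all add: map_le_def del: domIff)
qed

text \<open>The minimal operator is the adjoint of the maximal one, and adjoints are closed.\<close>

lemma That0_closed: "closed_operator S0"
  using closed_operator_adjoint[OF densely_defined_mono[OF That0_dense
        map_le_implies_dom_le[OF That0_le_That1]]]
  unfolding adjoint_That1 .

section \<open>Defect spaces and boundary conditions in the orthogonal sum\<close>

lemma mem_defect_space_That0:
  "(x, a) \<in> defect_space S0 c \<longleftrightarrow> x \<in> defect_space T0 c \<and> B a - \<Omega> x = c *\<^sub>C a"
proof (cases "x \<in> dom A")
  case True
  then show ?thesis unfolding defect_space_def adjoint_That0 dom_That1 by (simp add: the_That1)
next
  case False
  then show ?thesis unfolding defect_space_def adjoint_That0 dom_That1 by simp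
qed

text \<open>
  As \<open>B - c\<close> is bijective, the second component of a defect vector is determined by the first,
  which can be prescribed arbitrarily.
\<close>

lemma defect_space_That0:
  assumes c: "c \<in> {\<i>, - \<i>}" and fin: "cfinite_dim (defect_space T0 c)"
  shows "cfinite_dim (defect_space S0 c)" and "cdim (defect_space S0 c) = cdim (defect_space T0 c)"
proof -
  let ?d = "cdim (defect_space T0 c)"
  \<comment> \<open>B - c is treated as B plus the opposite constant, the form covered by the range
    and injectivity results.\<close>
  have c': "- c \<in> {\<i>, - \<i>}" using c by auto
  have solve: "\<exists>a. B a - c *\<^sub>C a = b" for b
    using self_adjoint_range[OF B_self_adjoint c', of b]
    by (auto simp: complex_vector.scale_minus_left)
  have unique: "a = 0" if "B a = c *\<^sub>C a" for a
    using symmetric_range_eq_zeroD[OF self_adjoint_symmetric[OF B_self_adjoint] c', of a] that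
    by (simp add: complex_vector.scale_minus_left)
  obtain n where n: "n ` {1..?d} \<subseteq> defect_space T0 c" "lin_indep_mod ?d n {0}"
    "defect_space T0 c \<subseteq> cspan (n ` {1..?d})"
    using family_basis_exists[OF fin] by blast
  obtain r where r: "\<And>j. B (r j) - c *\<^sub>C r j = \<Omega> (n j)"
    using choice[of "\<lambda>j a. B a - c *\<^sub>C a = \<Omega> (n j)"] solve by auto
  let ?n = "\<lambda>j. (n j, r j)"
  have mem: "?n ` {1..?d} \<subseteq> defect_space S0 c"
    using n(1) r by (auto simp: mem_defect_space_That0 algebra_simps)
  have fst_sum: "fst (\<Sum>j\<in>A. \<alpha> j *\<^sub>C ?n j) = (\<Sum>j\<in>A. \<alpha> j *\<^sub>C n j)" for \<alpha> and A :: "nat set"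
    by (induction A rule: infinite_finite_induct) auto
  have indep: "lin_indep_mod ?d ?n {0}"
    unfolding lin_indep_mod_def
  proof (intro allI impI)
    fix \<alpha> assume "(\<Sum>j\<in>{1..?d}. \<alpha> j *\<^sub>C ?n j) \<in> {0}"
    then have "(\<Sum>j\<in>{1..?d}. \<alpha> j *\<^sub>C n j) \<in> {0}"
      using fst_sum[of \<alpha> "{1..?d}"] by simp
    then show "\<forall>j\<in>{1..?d}. \<alpha> j = 0" using n(2) unfolding lin_indep_mod_def by blast
  qed
  have span: "defect_space S0 c \<subseteq> cspan (?n ` {1..?d})"
  proof
    fix z assume z: "z \<in> defect_space S0 c"
    then have "fst z \<in> defect_space T0 c" using mem_defect_space_That0[of "fst z" "snd z"] by simp
    then obtain \<alpha> where \<alpha>: "fst z = (\<Sum>j\<in>{1..?d}. \<alpha> j *\<^sub>C n j)"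
      using cspan_familyE subsetD[OF n(3)] by metis
    let ?w = "\<Sum>j\<in>{1..?d}. \<alpha> j *\<^sub>C ?n j"
    note sub = defect_space_subspace[OF That0_dense, of c]
    have "?w \<in> defect_space S0 c"
      using mem by (intro complex_vector.subspace_sum[OF sub] complex_vector.subspace_scale[OF sub]) blast
    then have "z - ?w \<in> defect_space S0 c" by (rule complex_vector.subspace_diff[OF sub z])
    \<comment> \<open>A defect vector with first component zero satisfies B a = c a, and the
      imaginary c is not an eigenvalue of the self-adjoint B.\<close>
    moreover have fst0: "fst (z - ?w) = 0" using \<alpha> fst_sum[of \<alpha> "{1..?d}"] by simp
    ultimately have "B (snd (z - ?w)) - \<Omega> 0 = c *\<^sub>C snd (z - ?w)"
      using mem_defect_space_That0[of 0 "snd (z - ?w)" c] by (metis prod.collapse)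
    moreover have "\<Omega> 0 = 0"
      using Omega_scale[OF complex_vector.subspace_0[OF subspace1], of 0] by simp
    ultimately have "snd (z - ?w) = 0" by (intro unique) simp
    with fst0 have "z - ?w = 0" by (simp add: prod_eq_iff)
    then have "z = ?w" by simp
    also have "?w \<in> cspan (?n ` {1..?d})" by (rule family_in_cspan)
    finally show "z \<in> cspan (?n ` {1..?d})" .
  qed
  show "cfinite_dim (defect_space S0 c)" by (rule family_basis_cdim(1)[OF mem indep span])
  show "cdim (defect_space S0 c) = ?d" by (rule family_basis_cdim(2)[OF mem indep span])
qed

text \<open>With the \<open>v j\<close> in the maximal domain both forms give the same conditions,
  so the operator becomes a restriction of the adjoint of \<open>S0\<close> of the kind treated
  abstractly.\<close>

lemma boundary_restriction_eq:
  assumes "v ` {1..n} \<subseteq> dom S1"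
  shows "boundary_restriction A t \<xi> B n v =
    op_on {z \<in> dom S1. \<forall>j\<in>{1..n}. bform S1 z (v j) = 0} (\<lambda>z. the (S1 z))"
proof -
  have "{z \<in> dom S1. \<forall>j\<in>{1..n}. bform_hat A t \<xi> z (v j) = 0}
      = {z \<in> dom S1. \<forall>j\<in>{1..n}. bform S1 z (v j) = 0}"
    by (intro Collect_cong conj_cong ball_cong refl) (simp only: bform_That1[OF _ subsetD[OF assms imageI]])
  moreover have "(case z of (x, a) \<Rightarrow> (the (A x), B a - \<Omega> x)) = the (S1 z)" if "z \<in> dom S1" for z
  proof -
    obtain x a where z: "z = (x, a)" by (metis prod.exhaust)
    have "x \<in> dom A" using that unfolding z dom_That1 by blast
    then show ?thesis unfolding z by (simp add: the_That1)
  qed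
  ultimately show ?thesis
    unfolding boundary_restriction_def by (intro operator_eqI) simp_all
qed

end

theorem theorem4p4:
  fixes T0 T1 :: "('h::chilbert_space, 'h) operator"
    and B :: "'w::chilbert_space \<Rightarrow> 'w"
    and \<xi> :: "nat \<Rightarrow> 'w"
    and t :: "nat \<Rightarrow> 'h"
  assumes T0_closed: "closed_operator T0"
    and T0_symmetric: "symmetric_operator T0"
    and T0_deficiency: "equal_finite_deficiency T0"
    and T1_adjoint: "T1 = op_adjoint T0"
    and W_finite_dim: "cfinite_dim (UNIV :: 'w set)"
    and W_dim_le: "cdim (UNIV :: 'w set) \<le> deficiency T0"
    and \<xi>_basis: "orthonormal_basis (cdim (UNIV :: 'w set)) \<xi>"
    and B_self_adjoint: "self_adjoint (op_on UNIV B)"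
    and t_GKN: "partial_GKN_set T0 T1 (cdim (UNIV :: 'w set)) t"
  shows
    "(closed_operator (That0 T0 T1 t \<xi> B) \<and>
      symmetric_operator (That0 T0 T1 t \<xi> B) \<and>
      That0 T0 T1 t \<xi> B \<subseteq>\<^sub>m That1 T1 t \<xi> B \<and>
      op_adjoint (That0 T0 T1 t \<xi> B) = That1 T1 t \<xi> B \<and>
      op_adjoint (That1 T1 t \<xi> B) = That0 T0 T1 t \<xi> B) \<and>
     (equal_finite_deficiency (That0 T0 T1 t \<xi> B) \<and>
      deficiency (That0 T0 T1 t \<xi> B) = deficiency T0) \<and>
     (\<forall>That.
        self_adjoint That \<and> That0 T0 T1 t \<xi> B \<subseteq>\<^sub>m That \<and> That \<subseteq>\<^sub>m That1 T1 t \<xi> B \<longrightarrow>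
        (\<exists>v. (\<forall>j\<in>{1..deficiency T0}. v j \<in> dom (That1 T1 t \<xi> B)) \<and>
          lin_indep_mod (deficiency T0) v (dom (That0 T0 T1 t \<xi> B)) \<and>
          (\<forall>j\<in>{1..deficiency T0}. \<forall>k\<in>{1..deficiency T0}. bform_hat T1 t \<xi> (v j) (v k) = 0) \<and>
          That = boundary_restriction T1 t \<xi> B (deficiency T0) v)) \<and>
     (\<forall>v.
        (\<forall>j\<in>{1..deficiency T0}. v j \<in> dom (That1 T1 t \<xi> B)) \<and>
        lin_indep_mod (deficiency T0) v (dom (That0 T0 T1 t \<xi> B)) \<and>
        (\<forall>j\<in>{1..deficiency T0}. \<forall>k\<in>{1..deficiency T0}. bform_hat T1 t \<xi> (v j) (v k) = 0) \<longrightarrow>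
        self_adjoint (boundary_restriction T1 t \<xi> B (deficiency T0) v) \<and>
        That0 T0 T1 t \<xi> B \<subseteq>\<^sub>m boundary_restriction T1 t \<xi> B (deficiency T0) v \<and>
        boundary_restriction T1 t \<xi> B (deficiency T0) v \<subseteq>\<^sub>m That1 T1 t \<xi> B)"
proof -
  interpret extended_operators T0 B \<xi> t "cdim (UNIV :: 'w set)"
    using T0_closed T0_symmetric \<xi>_basis B_self_adjoint t_GKN
    unfolding T1_adjoint by unfold_locales simp_all
  have deficiency: "equal_finite_deficiency S0" "deficiency S0 = deficiency T0"
    using T0_deficiency defect_space_That0[of \<i>] defect_space_That0[of "- \<i>"]
    unfolding equal_finite_deficiency_def deficiency_def by auto
  have necessary: "\<exists>v. (\<forall>j\<in>{1..deficiency T0}. v j \<in> dom S1) \<and>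
      lin_indep_mod (deficiency T0) v (dom S0) \<and>
      (\<forall>j\<in>{1..deficiency T0}. \<forall>k\<in>{1..deficiency T0}. bform_hat A t \<xi> (v j) (v k) = 0) \<and>
      That = boundary_restriction A t \<xi> B (deficiency T0) v"
    if That: "self_adjoint That" "S0 \<subseteq>\<^sub>m That" "That \<subseteq>\<^sub>m S1" for That
  proof -
    have fin: "cfinite_dim (defect_space S0 \<i>)"
      using deficiency(1) unfolding equal_finite_deficiency_def by blast
    obtain v where v: "\<And>j. j \<in> {1..deficiency T0} \<Longrightarrow> v j \<in> dom That"
      "lin_indep_mod (deficiency T0) v (dom S0)"
      "dom That = {z \<in> dom S1. \<forall>j\<in>{1..deficiency T0}. bform S1 z (v j) = 0}"
      using self_adjoint_extension_boundary_conditions[OF That0_closed That0_symmetric fin That(1,2)]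
      unfolding adjoint_That0 deficiency(2) by blast
    have v1: "v j \<in> dom S1" if "j \<in> {1..deficiency T0}" for j
      using v(1)[OF that] map_le_implies_dom_le[OF That(3)] by blast
    then have v_sub: "v ` {1..deficiency T0} \<subseteq> dom S1" by (rule image_subsetI)
    \<comment> \<open>Isotropy comes for free: \<open>v j\<close> lies in \<open>dom That\<close>,
      whose description contains the condition against \<open>v k\<close>.\<close>
    have "bform_hat A t \<xi> (v j) (v k) = 0" if jk: "j \<in> {1..deficiency T0}" "k \<in> {1..deficiency T0}" for j k
      using v(1)[OF jk(1)] jk(2) bform_That1[OF v1 v1, OF jk] unfolding v(3) by simp
    moreover have "That = boundary_restriction A t \<xi> B (deficiency T0) v"
      unfolding boundary_restriction_eq[OF v_sub] v(3)[symmetric]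
      using That(3) unfolding map_le_iff_the by (intro operator_eqI) (simp_all del: domIff)
    ultimately show ?thesis using v(2) v1 by blast
  qed
  have sufficient: "self_adjoint (boundary_restriction A t \<xi> B (deficiency T0) v) \<and>
      S0 \<subseteq>\<^sub>m boundary_restriction A t \<xi> B (deficiency T0) v \<and>
      boundary_restriction A t \<xi> B (deficiency T0) v \<subseteq>\<^sub>m S1"
    if v: "\<forall>j\<in>{1..deficiency T0}. v j \<in> dom S1" "lin_indep_mod (deficiency T0) v (dom S0)"
      "\<forall>j\<in>{1..deficiency T0}. \<forall>k\<in>{1..deficiency T0}. bform_hat A t \<xi> (v j) (v k) = 0" for v
  proof -
    note v1 = bspec[OF v(1)]
    have v_sub: "v ` {1..deficiency T0} \<subseteq> dom S1" using v(1) by blast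
    have "bform S1 (v j) (v k) = 0" if "j \<in> {1..deficiency T0}" "k \<in> {1..deficiency T0}" for j k
      using v(3) that bform_That1[OF v1 v1, OF that] by simp
    \<comment> \<open>The rewriting replaces the adjoint of \<open>S0\<close> by \<open>S1\<close>
      and its deficiency by that of \<open>T0\<close>, which fits the abstract theorem to the given
      vectors.\<close>
    note thms = boundary_conditions_self_adjoint[OF That0_closed That0_symmetric deficiency(1),
        unfolded adjoint_That0 deficiency(2), OF v1 v(2) this]
    show ?thesis
      unfolding boundary_restriction_eq[OF v_sub]
      using thms by (auto simp: map_le_iff_the)
  qed
  show ?thesis
    unfolding T1_adjoint
    using That0_closed That0_symmetric That0_le_That1 adjoint_That0 adjoint_That1 deficiency
      necessary sufficient
    by blast
qed

end
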